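(* Let $n\ge1$, $0<s<1$, $\lambda\in\mathbb{R}$, and let $$w\in C^{2s+\epsilon,s+\epsilon}_{x,\,t,\,{\rm loc}}(\Sigma_\lambda\times\mathbb{R})\cap\mathcal{L}(\mathbb{R}^n\times\mathbb{R})$$ for some $\epsilon>0$ be upper semi-continuous up to the boundary $T_\lambda$ and bounded from above in $\Sigma_\lambda\times\mathbb{R}$. Suppose that $$\begin{cases}(\partial_t-\Delta)^s w(x,t)\le 0 & \text{at the points of }\Sigma_\lambda\times\mathbb{R}\text{ where }w(x,t)>0,\\ w(x,t)=-w(x^\lambda,t) & \text{in }\Sigma_\lambda\times\mathbb{R}.\end{cases}$$ Then $w(x,t)\le 0$ in $\Sigma_\lambda\times\mathbb{R}$.
   Context: For $0<s<1$, the fully fractional heat operator is defined pointwise by $$(\partial_t-\Delta)^s u(x,t):=C_{n,s}\int_{-\infty}^{t}\int_{\mathbb{R}^n}\frac{u(x,t)-u(y,\tau)}{(t-\tau)^{\frac n2+1+s}}e^{-\frac{|x-y|^2}{4(t-\tau)}}\,dy\,d\tau,\qquad C_{n,s}=\frac{1}{(4\pi)^{n/2}|\Gamma(-s)|},$$ with the $y$-integral taken in the Cauchy principal value sense. The space $\mathcal{L}(\mathbb{R}^n\times\mathbb{R})$ consists of $u\in L^1_{\rm loc}(\mathbb{R}^n\times\mathbb{R})$ such that $\int_{-\infty}^t\int_{\mathbb{R}^n}\frac{|u(x,\tau)|e^{-|x|^2/(4(t-\tau))}}{1+(t-\tau)^{\frac n2+1+s}}\,dx\,d\tau<\infty$ for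 every $t\in\mathbb{R}$. The parabolic Hölder space $C^{2\alpha,\alpha}_{x,t}$: for $0<\alpha\le\frac12$, $|u(x,t)-u(y,\tau)|\le C(|x-y|+|t-\tau|^{1/2})^{2\alpha}$; for $\frac12<\alpha\le1$, $u$ is $\alpha$-Hölder in $t$ uniformly in $x$ and $\nabla_x u$ is $(2\alpha-1)$-Hölder in $x$ uniformly in $t$ and $(\alpha-\frac12)$-Hölder in $t$ uniformly in $x$; for $\alpha>1$, $\partial_t u, D_x^2u\in C^{2\alpha-2,\alpha-1}_{x,t}$; "loc" means these hold locally. Notation: $T_\lambda=\{x\in\mathbb{R}^n\mid x_1=\lambda\}$, $\Sigma_\lambda=\{x\in\mathbb{R}^n\mid x_1<\lambda\}$, and $x^\lambda=(2\lambda-x_1,x_2,\dots,x_n)$. *)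

theory Defs
  imports "HOL-Analysis.Analysis"
begin

text \<open>Points of R^n are vectors real^'n, indexed by a finite well-ordered type 'n
  (so n = CARD('n) >= 1); the first coordinate x_1 is the component at the
  least index.\<close>

definition fst_idx :: "'n::{finite,wellorder}" where
  "fst_idx = (LEAST i. True)"

definition x1 :: "real^'n::{finite,wellorder} \<Rightarrow> real" where
  "x1 x = x $ fst_idx"

definition Sigma_lam :: "real \<Rightarrow> (real^'n::{finite,wellorder}) set" where
  "Sigma_lam lam = {x. x1 x < lam}"

definition T_lam :: "real \<Rightarrow> (real^'n::{finite,wellorder}) set" where
  "T_lam lam = {x. x1 x = lam}"

definition refl_lam :: "real \<Rightarrow> real^('n::{finite,wellorder}) \<Rightarrow> real^('n::{finite,wellorder})" where
  "refl_lam lam x = (\<chi> i. if i = fst_idx then 2 * lam - x $ i else x $ i)"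

definition C_ns :: "nat \<Rightarrow> real \<Rightarrow> real" where
  "C_ns n s = 1 / ((4 * pi) powr (real n / 2) * \<bar>Gamma (- s)\<bar>)"

definition frac_heat_integrand ::
  "real \<Rightarrow> (real^'n::finite \<Rightarrow> real \<Rightarrow> real) \<Rightarrow> real^'n \<Rightarrow> real \<Rightarrow> real^'n \<Rightarrow> real \<Rightarrow> real" where
  "frac_heat_integrand s u x t y \<tau> =
     (u x t - u y \<tau>) / (t - \<tau>) powr (real CARD('n) / 2 + 1 + s)
       * exp (- (norm (x - y))\<^sup>2 / (4 * (t - \<tau>)))"

definition frac_heat_inner ::
  "real \<Rightarrow> (real^'n::finite \<Rightarrow> real \<Rightarrow> real) \<Rightarrow> real^'n \<Rightarrow> real \<Rightarrow> real \<Rightarrow> real" where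
  "frac_heat_inner s u x t \<tau> =
     Lim (at_right 0) (\<lambda>\<delta>. LINT y : {y. dist y x > \<delta>} | lborel. frac_heat_integrand s u x t y \<tau>)"

definition frac_heat ::
  "real \<Rightarrow> (real^'n::finite \<Rightarrow> real \<Rightarrow> real) \<Rightarrow> real^'n \<Rightarrow> real \<Rightarrow> real" where
  "frac_heat s u x t =
     C_ns CARD('n) s * (LINT \<tau> : {..<t} | lborel. frac_heat_inner s u x t \<tau>)"

definition space_L :: "real \<Rightarrow> (real^'n::finite \<Rightarrow> real \<Rightarrow> real) set" where
  "space_L s = {u.
     (\<forall>K. compact K \<longrightarrow> set_integrable lborel K (\<lambda>p::(real^'n) \<times> real. u (fst p) (snd p))) \<and>
     (\<forall>t. (\<integral>\<^sup>+ p. ennreal (indicator {p::(real^'n) \<times> real. snd p < t} p *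
              (\<bar>u (fst p) (snd p)\<bar> * exp (- (norm (fst p))\<^sup>2 / (4 * (t - snd p)))
               / (1 + (t - snd p) powr (real CARD('n) / 2 + 1 + s)))) \<partial>lborel) < \<infinity>)}"

definition axis_dir :: "'n::finite \<Rightarrow> real^'n" where
  "axis_dir i = axis i 1"

definition has_dx :: "'n::finite \<Rightarrow> (real^'n \<Rightarrow> real \<Rightarrow> real) \<Rightarrow> real^'n \<Rightarrow> real \<Rightarrow> bool" where
  "has_dx i u x t \<longleftrightarrow> (\<lambda>h. u (x + h *\<^sub>R axis_dir i) t) differentiable (at 0)"

definition dx :: "'n::finite \<Rightarrow> (real^'n \<Rightarrow> real \<Rightarrow> real) \<Rightarrow> real^'n \<Rightarrow> real \<Rightarrow> real" where
  "dx i u x t = deriv (\<lambda>h. u (x + h *\<^sub>R axis_dir i) t) 0"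

definition has_dt :: "(real^'n::finite \<Rightarrow> real \<Rightarrow> real) \<Rightarrow> real^'n \<Rightarrow> real \<Rightarrow> bool" where
  "has_dt u x t \<longleftrightarrow> (\<lambda>\<tau>. u x \<tau>) differentiable (at t)"

definition dt :: "(real^'n::finite \<Rightarrow> real \<Rightarrow> real) \<Rightarrow> real^'n \<Rightarrow> real \<Rightarrow> real" where
  "dt u x t = deriv (\<lambda>\<tau>. u x \<tau>) t"

text \<open>Base cases 0 < alpha <= 1 of C^{2 alpha, alpha}_loc on an (open) set Omega:
  the estimates hold with some constant on every compact subset of Omega.\<close>
definition par_holder_base ::
  "real \<Rightarrow> ((real^'n::finite) \<times> real) set \<Rightarrow> (real^'n \<Rightarrow> real \<Rightarrow> real) \<Rightarrow> bool" where
  "par_holder_base \<alpha> \<Omega> u \<longleftrightarrow>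
     (if \<alpha> \<le> 1/2 then
        (\<forall>K. compact K \<and> K \<subseteq> \<Omega> \<longrightarrow> (\<exists>C. \<forall>x t y \<tau>. (x,t) \<in> K \<and> (y,\<tau>) \<in> K \<longrightarrow>
           \<bar>u x t - u y \<tau>\<bar> \<le> C * (norm (x - y) + sqrt \<bar>t - \<tau>\<bar>) powr (2 * \<alpha>)))
      else
        (\<forall>i. \<forall>(x,t)\<in>\<Omega>. has_dx i u x t) \<and>
        (\<forall>K. compact K \<and> K \<subseteq> \<Omega> \<longrightarrow> (\<exists>C.
           (\<forall>x t \<tau>. (x,t) \<in> K \<and> (x,\<tau>) \<in> K \<longrightarrow> \<bar>u x t - u x \<tau>\<bar> \<le> C * \<bar>t - \<tau>\<bar> powr \<alpha>) \<and>
           (\<forall>i x y t. (x,t) \<in> K \<and> (y,t) \<in> K \<longrightarrow>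
               \<bar>dx i u x t - dx i u y t\<bar> \<le> C * norm (x - y) powr (2 * \<alpha> - 1)) \<and>
           (\<forall>i x t \<tau>. (x,t) \<in> K \<and> (x,\<tau>) \<in> K \<longrightarrow>
               \<bar>dx i u x t - dx i u x \<tau>\<bar> \<le> C * \<bar>t - \<tau>\<bar> powr (\<alpha> - 1/2)))))"

text \<open>Recursive definition: for alpha > 1, u_t and D_x^2 u lie in C^{2alpha-2,alpha-1}_loc.
  The nat argument is fuel (ceiling of alpha suffices).\<close>
fun par_holder_fuel ::
  "nat \<Rightarrow> real \<Rightarrow> ((real^'n::finite) \<times> real) set \<Rightarrow> (real^'n \<Rightarrow> real \<Rightarrow> real) \<Rightarrow> bool" where
  "par_holder_fuel 0 \<alpha> \<Omega> u = (\<alpha> \<le> 1 \<and> par_holder_base \<alpha> \<Omega> u)"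
| "par_holder_fuel (Suc k) \<alpha> \<Omega> u =
     (if \<alpha> \<le> 1 then par_holder_base \<alpha> \<Omega> u
      else (\<forall>(x,t)\<in>\<Omega>. has_dt u x t \<and> (\<forall>i. has_dx i u x t \<and> (\<forall>j. has_dx i (dx j u) x t))) \<and>
           par_holder_fuel k (\<alpha> - 1) \<Omega> (dt u) \<and>
           (\<forall>i j. par_holder_fuel k (\<alpha> - 1) \<Omega> (dx i (dx j u))))"

definition par_holder_loc ::
  "real \<Rightarrow> ((real^'n::finite) \<times> real) set \<Rightarrow> (real^'n \<Rightarrow> real \<Rightarrow> real) \<Rightarrow> bool" where
  "par_holder_loc \<alpha> \<Omega> u \<longleftrightarrow> 0 < \<alpha> \<and> par_holder_fuel (nat \<lceil>\<alpha>\<rceil>) \<alpha> \<Omega> u"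

definition usc_on :: "('a::topological_space) set \<Rightarrow> ('a \<Rightarrow> real) \<Rightarrow> bool" where
  "usc_on S f \<longleftrightarrow> (\<forall>p\<in>S. \<forall>e>0. \<forall>\<^sub>F q in at p within S. f q < f p + e)"

end

theory Submission
  imports Defs "HOL-Probability.Distributions"
begin

text \<open>Suppose \<open>A = sup w > 0\<close> on the half space. Pick \<open>(x0, t0)\<close> with \<open>w x0 t0 > A - e\<close> and add \<open>e\<close> times a
  bump supported in the parabolic cylinder around \<open>(x0, t0)\<close> whose radius \<open>r\<close> is half the distance of
  \<open>x0\<close> to the reflecting hyperplane. The perturbed function exceeds \<open>A\<close> at \<open>(x0, t0)\<close>, hence attains its maximum over the half
  space at some \<open>(x, t)\<close> inside the cylinder. Folding the defining integral along the hyperplane,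
  antisymmetry and maximality bound the operator applied to the perturbed function at \<open>(x, t)\<close> from
  below by a multiple of \<open>A * r powr (- 2 * s)\<close>, while the bump contributes at most a
  multiple of \<open>e * r powr (- 2 * s)\<close>, with constants independent of \<open>r\<close>. For small \<open>e\<close> the operator applied to
  \<open>w\<close> is therefore positive at \<open>(x, t)\<close>, although \<open>w x t > 0\<close>.

  The integrals in the definition of the operator return junk values where they diverge, so their
  convergence at interior points has to be established: away from \<open>(x, t)\<close> it follows from
  membership in the weighted space, near \<open>(x, t)\<close> from a bound on symmetric second differences.\<close>

section \<open>Gaussian and power integrals, measure-preserving reflections\<close>

text \<open>The supremum need not be attained, and points where it is nearly attained may run off to
  infinity or to the hyperplane as \<open>e\<close> shrinks, so \<open>r\<close> has no lower bound.
  This forces the order of choices: first \<open>e\<close>, then \<open>x0\<close> and with it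
  \<open>r\<close>; the smallness condition on \<open>e\<close> must not mention \<open>r\<close>.
  Parabolic scaling achieves this. The bump has width \<open>r\<close> in space and r^2 in time, and
  with h = t - \<tau> the two contributions are, up to constants, the integral of h^(-1-s) over h
  \<ge> r^2 and r^(-2) times the integral of h^(-s) over h < r^2; both are multiples of r^(-2s).
  Folding is needed because \<open>w\<close> is bounded only from above: beyond the hyperplane it is
  minus its mirror value, so maximality gives no pointwise sign there. A pair of mirror points does
  have a sign. The point in the half space has a nonnegative difference to the maximum and the
  larger kernel weight, and the two values of the perturbed function add up to at most
  \<open>e\<close>.\<close>

lemma nn_integral_gaussian_real:
  fixes c :: real
  assumes "c > 0"
  shows "(\<integral>\<^sup>+x. ennreal (exp (- x\<^sup>2 / c)) \<partial>lborel) = ennreal (sqrt (pi * c))"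
proof -
  define \<sigma> where "\<sigma> = sqrt (c / 2)"
  have sg: "\<sigma> > 0" "2 * \<sigma>\<^sup>2 = c" using assms by (auto simp: \<sigma>_def)
  then have "2 * pi * \<sigma>\<^sup>2 = pi * c" by (metis mult.commute mult.left_commute)
  have "(\<integral>\<^sup>+x. ennreal (exp (- x\<^sup>2 / c)) \<partial>lborel)
      = (\<integral>\<^sup>+x. ennreal (sqrt (pi * c)) * ennreal (normal_density 0 \<sigma> x) \<partial>lborel)"
  proof (intro nn_integral_cong)
    fix x
    show "ennreal (exp (- x\<^sup>2 / c)) = ennreal (sqrt (pi * c)) * ennreal (normal_density 0 \<sigma> x)"
      unfolding normal_density_def \<open>2 * pi * \<sigma>\<^sup>2 = pi * c\<close> sg(2)
      using assms by (simp add: ennreal_mult[symmetric])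
  qed
  also have "\<dots> = ennreal (sqrt (pi * c)) * (\<integral>\<^sup>+x. ennreal (normal_density 0 \<sigma> x) \<partial>lborel)"
    by (intro nn_integral_cmult) simp
  also have "(\<integral>\<^sup>+x. ennreal (normal_density 0 \<sigma> x) \<partial>lborel) = 1"
    using sg by (subst nn_integral_eq_integral) auto
  finally show ?thesis by simp
qed

lemma has_bochner_integral_gaussian:
  fixes c :: real
  assumes c: "c > 0"
  shows "has_bochner_integral lborel (\<lambda>z::real^'n::finite. exp (- (norm z)\<^sup>2 / c))
           ((pi * c) powr (real CARD('n) / 2))"
proof (rule has_bochner_integral_nn_integral)
  have "(\<integral>\<^sup>+(z::real^'n). ennreal (exp (- (norm z)\<^sup>2 / c)) \<partial>lborel)
      = (\<integral>\<^sup>+(z::real^'n). (\<Prod>b\<in>Basis. ennreal (exp (- (z \<bullet> b)\<^sup>2 / c))) \<partial>lborel)"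
  proof (intro nn_integral_cong)
    fix z :: "real^'n"
    have "(norm z)\<^sup>2 = (\<Sum>b\<in>Basis. (z \<bullet> b)\<^sup>2)"
      by (subst power2_norm_eq_inner, subst euclidean_inner) (simp add: power2_eq_square)
    then have "- (norm z)\<^sup>2 / c = (\<Sum>b\<in>Basis. - (z \<bullet> b)\<^sup>2 / c)"
      by (simp add: sum_negf sum_divide_distrib)
    then show "ennreal (exp (- (norm z)\<^sup>2 / c)) = (\<Prod>b\<in>Basis. ennreal (exp (- (z \<bullet> b)\<^sup>2 / c)))"
      by (simp add: exp_sum prod_ennreal)
  qed
  also have "\<dots> = (\<Prod>b\<in>(Basis::(real^'n) set). \<integral>\<^sup>+x. ennreal (exp (- x\<^sup>2 / c)) \<partial>lborel)"
    by (subst nn_integral_lborel_prod) auto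
  also have "\<dots> = ennreal (sqrt (pi * c) ^ CARD('n))"
    unfolding nn_integral_gaussian_real[OF c] using c by (simp add: ennreal_power)
  also have "sqrt (pi * c) ^ CARD('n) = (pi * c) powr (real CARD('n) / 2)"
    using c by (simp add: powr_half_sqrt[symmetric] powr_powr flip: powr_realpow)
  finally show "(\<integral>\<^sup>+(z::real^'n). ennreal (exp (- (norm z)\<^sup>2 / c)) \<partial>lborel)
      = ennreal ((pi * c) powr (real CARD('n) / 2))" .
qed auto

text \<open>Covers both reflections used below: through a point, where all signs are -1, and in the
  hyperplane, where only the sign of the first coordinate is -1.\<close>

lemma distr_lborel_signs:
  fixes T :: "'a::euclidean_space \<Rightarrow> 'a" and a :: 'a and c :: "'a \<Rightarrow> real"
  assumes c: "\<And>j. j \<in> Basis \<Longrightarrow> \<bar>c j\<bar> = 1"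
    and T: "\<And>x. T x = a + (\<Sum>j\<in>Basis. (c j * (x \<bullet> j)) *\<^sub>R j)"
  shows "distr lborel borel T = lborel"
proof -
  have "lborel = density (distr lborel borel T) (\<lambda>_. ennreal (\<Prod>j\<in>Basis. \<bar>c j\<bar>))"
    unfolding T[abs_def] using c by (intro lborel_affine_euclidean) (metis abs_0 zero_neq_one)
  also have "(\<Prod>j\<in>Basis. \<bar>c j\<bar>) = 1" using c by simp
  finally show ?thesis by (simp add: density_1)
qed

lemma distr_lborel_reflect_point: "distr lborel borel (\<lambda>z. x - z) = (lborel :: 'a::euclidean_space measure)"
  by (rule distr_lborel_signs[where a = x and c = "\<lambda>_. -1"])
    (auto simp: euclidean_representation sum_negf)

lemma distr_lborel_translate: "distr lborel borel (\<lambda>z. x + z) = (lborel :: 'a::euclidean_space measure)"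
  using lborel_distr_plus[of x] by simp

lemma distr_lborel_refl_lam: "distr lborel borel (refl_lam lam) = lborel"
proof (rule distr_lborel_signs[where a = "axis fst_idx (2 * lam)" and c = "\<lambda>j. if j = axis fst_idx 1 then -1 else 1"])
  fix x :: "real^'n::{finite,wellorder}"
  show "refl_lam lam x = axis fst_idx (2 * lam) +
    (\<Sum>j\<in>Basis. ((if j = axis fst_idx 1 then - 1 else 1) * (x \<bullet> j)) *\<^sub>R j)"
  proof (rule vec_eq_iff[THEN iffD2], rule allI)
    fix i
    have "(\<Sum>j\<in>Basis. ((if j = axis fst_idx 1 then - 1 else 1) * (x \<bullet> j)) *\<^sub>R j) $ i
      = (\<Sum>j\<in>Basis. ((if j = axis fst_idx 1 then - 1 else 1) * (x \<bullet> j)) *\<^sub>R j) \<bullet> axis i 1"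
      by (simp add: inner_axis)
    also have "\<dots> = (if axis i (1::real) = axis fst_idx 1 then - 1 else 1) * (x \<bullet> axis i 1)"
      by (subst inner_sum_left_Basis) auto
    finally show "refl_lam lam x $ i = (axis fst_idx (2 * lam) +
         (\<Sum>j\<in>Basis. ((if j = axis fst_idx 1 then - 1 else 1) * (x \<bullet> j)) *\<^sub>R j)) $ i"
      by (auto simp: refl_lam_def inner_axis axis_eq_axis) (simp add: axis_def)+
  qed
qed auto

lemma
  fixes f :: "'a::euclidean_space \<Rightarrow> real"
  assumes T: "distr lborel borel T = lborel" and T': "T \<in> borel_measurable borel"
    and f: "f \<in> borel_measurable borel"
  shows integral_lborel_preserving: "(LINT x|lborel. f (T x)) = (LINT x|lborel. f x)"
    and integrable_lborel_preserving: "integrable lborel (\<lambda>x. f (T x)) \<longleftrightarrow> integrable lborel f"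
proof -
  have [measurable]: "T \<in> borel_measurable borel" "f \<in> borel_measurable borel" using assms by auto
  show "(LINT x|lborel. f (T x)) = (LINT x|lborel. f x)"
    using integral_distr[of T lborel borel f] by (simp add: T)
  show "integrable lborel (\<lambda>x. f (T x)) \<longleftrightarrow> integrable lborel f"
    using integrable_distr_eq[of T lborel borel f] by (simp add: T)
qed

text \<open>Against a kernel that is even about \<open>x\<close>, this average turns differences
  u(x) - u(y) into symmetric second differences, in which the linear part of u cancels.\<close>

lemma integral_symmetrize_point:
  fixes f :: "'a::euclidean_space \<Rightarrow> real"
  assumes f: "integrable lborel f"
  shows "integrable lborel (\<lambda>z. f (x + z) + f (x - z))"
    and "(LINT y|lborel. f y) = (LINT z|lborel. (f (x + z) + f (x - z)) / 2)"
proof -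
  have [measurable]: "f \<in> borel_measurable borel" using f by auto
  have i: "integrable lborel (\<lambda>z. f (x + z))" "integrable lborel (\<lambda>z. f (x - z))"
    using f by (auto simp: integrable_lborel_preserving[OF distr_lborel_translate]
      integrable_lborel_preserving[OF distr_lborel_reflect_point])
  then show "integrable lborel (\<lambda>z. f (x + z) + f (x - z))" by auto
  show "(LINT y|lborel. f y) = (LINT z|lborel. (f (x + z) + f (x - z)) / 2)"
    using i by (simp add: integral_lborel_preserving[OF distr_lborel_translate]
      integral_lborel_preserving[OF distr_lborel_reflect_point])
qed

lemma borel_measurable_refl_lam [measurable]:
  "(refl_lam lam :: real^'n::{finite,wellorder} \<Rightarrow> _) \<in> borel_measurable borel"
proof -
  have "continuous_on UNIV (refl_lam lam :: real^'n::{finite,wellorder} \<Rightarrow> _)"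
    unfolding refl_lam_def
  proof (intro continuous_on_vec_lambda)
    show "continuous_on UNIV (\<lambda>x::real^'n::{finite,wellorder}. if i = fst_idx then 2 * lam - x $ i else x $ i)" for i
      by (cases "i = fst_idx") (auto intro!: continuous_intros)
  qed
  then show ?thesis by (rule borel_measurable_continuous_onI)
qed

text \<open>The folding identity, kept as an average over the whole space. The averaged integrand is
  invariant under the reflection, so a bound on it in the half space carries over to the other
  side.\<close>

lemma integral_symmetrize_refl:
  assumes f: "integrable lborel f"
  shows "integrable lborel (\<lambda>y. f y + f (refl_lam lam y) :: real)"
    and "(LINT y|lborel. f y) = (LINT y|lborel. (f y + f (refl_lam lam y)) / 2)"
proof -
  have [measurable]: "f \<in> borel_measurable borel" using f by auto
  have i: "integrable lborel (\<lambda>y. f (refl_lam lam y))"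
    using f by (auto simp: integrable_lborel_preserving[OF distr_lborel_refl_lam])
  then show "integrable lborel (\<lambda>y. f y + f (refl_lam lam y))" using f by auto
  show "(LINT y|lborel. f y) = (LINT y|lborel. (f y + f (refl_lam lam y)) / 2)"
    using i f by (simp add: integral_lborel_preserving[OF distr_lborel_refl_lam])
qed

lemma gaussian_integral_at:
  fixes c :: real and x :: "real^'n::finite"
  assumes c: "c > 0"
  shows "integrable lborel (\<lambda>y. exp (- (norm (x - y))\<^sup>2 / c))"
    and "(LINT y|lborel. exp (- (norm (x - y))\<^sup>2 / c)) = (pi * c) powr (real CARD('n) / 2)"
  using has_bochner_integral_gaussian[OF c, where 'n='n]
    integral_lborel_preserving[OF distr_lborel_reflect_point, of x "\<lambda>z::real^'n. exp (- (norm z)\<^sup>2 / c)"]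
    integrable_lborel_preserving[OF distr_lborel_reflect_point, of x "\<lambda>z::real^'n. exp (- (norm z)\<^sup>2 / c)"]
  by (auto simp: has_bochner_integral_iff)

section \<open>Power integrals over past times\<close>

lemma has_bochner_integral_of_has_integral:
  fixes f :: "real \<Rightarrow> real"
  assumes f: "(f has_integral I) S" and S: "S \<in> sets borel" "f \<in> borel_measurable borel"
    and nn: "\<And>x. x \<in> S \<Longrightarrow> 0 \<le> f x"
  shows "has_bochner_integral lborel (\<lambda>x. indicator S x * f x) I"
proof (rule has_bochner_integral_nn_integral)
  have eq: "indicator S x * f x = (if x \<in> S then f x else 0)" for x by simp
  show "I \<ge> 0" using f nn by (rule has_integral_nonneg)
  show "(\<lambda>x. indicator S x * f x) \<in> borel_measurable lborel" using S by measurable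
  then show "(\<integral>\<^sup>+x. ennreal (indicator S x * f x) \<partial>lborel) = ennreal I"
    using f nn by (intro nn_integral_has_integral_lborel) (auto simp: eq has_integral_restrict_UNIV)
qed (use nn in \<open>auto simp: indicator_def\<close>)

lemma has_bochner_integral_powr_near:
  fixes t b r :: real
  assumes "b > -1" "r > 0"
  shows "has_bochner_integral lborel (\<lambda>\<tau>. indicator {t - r..<t} \<tau> * (t - \<tau>) powr b) (r powr (b + 1) / (b + 1))"
proof -
  have "has_bochner_integral lborel (\<lambda>x. indicator {0..r} x * x powr b) (r powr (b + 1) / (b + 1))"
    using assms by (intro has_bochner_integral_of_has_integral has_integral_powr_from_0) auto
  then have "has_bochner_integral lborel (\<lambda>\<tau>. indicator {0..r} (t + (-1) * \<tau>) * (t + (-1) * \<tau>) powr b)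
      (r powr (b + 1) / (b + 1))"
    using lborel_has_bochner_integral_real_affine_iff[of "-1" "\<lambda>x. indicator {0..r} x * x powr b" _ t] by simp
  \<comment> \<open>The substitution produces the closed interval ending at \<open>t\<close>; the
    half-open one gives the same function because \<open>0 powr b = 0\<close>.\<close>
  then show ?thesis
    by (rule has_bochner_integral_cong[THEN iffD1, rotated -1]) (auto simp: indicator_def)
qed

lemma has_bochner_integral_powr_far:
  fixes t b r :: real
  assumes "b < -1" "r > 0"
  shows "has_bochner_integral lborel (\<lambda>\<tau>. indicator {..t - r} \<tau> * (t - \<tau>) powr b) (- (r powr (b + 1)) / (b + 1))"
proof -
  have "has_bochner_integral lborel (\<lambda>x. indicator {r..} x * x powr b) (- (r powr (b + 1)) / (b + 1))"
    using assms by (intro has_bochner_integral_of_has_integral has_integral_powr_to_inf) auto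
  then have "has_bochner_integral lborel (\<lambda>\<tau>. indicator {r..} (t + (-1) * \<tau>) * (t + (-1) * \<tau>) powr b)
      (- (r powr (b + 1)) / (b + 1))"
    using lborel_has_bochner_integral_real_affine_iff[of "-1" "\<lambda>x. indicator {r..} x * x powr b" _ t] by simp
  then show ?thesis
    by (rule has_bochner_integral_cong[THEN iffD1, rotated -1]) (auto simp: indicator_def)
qed

section \<open>Consequences of parabolic Hoelder regularity\<close>

text \<open>Only partial derivatives are given, so the mean value theorem is applied along a path
  that changes one coordinate at a time, which costs the factor \<open>CARD('n)\<close>. The path
  stays in the ball because every coordinate of its displacement from \<open>x\<close> is at most
  that of \<open>y - x\<close> in absolute value.\<close>

lemma partials_bounded_imp_diff_bound:
  fixes f :: "real^'n::finite \<Rightarrow> real"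
  assumes deriv: "\<And>u i. norm (u - x) \<le> norm (y - x) \<Longrightarrow>
      ((\<lambda>h. f (u + h *\<^sub>R axis_dir i)) has_real_derivative g i u) (at 0)"
    and bound: "\<And>u i. norm (u - x) \<le> norm (y - x) \<Longrightarrow> \<bar>g i u\<bar> \<le> C"
  shows "\<bar>f y - f x\<bar> \<le> C * (real CARD('n) * norm (y - x))"
proof -
  define p where "p S = (\<chi> i. if i \<in> S then y $ i else x $ i)" for S
  \<comment> \<open>Index types are nonempty, so an arbitrary index yields
    \<open>C \<ge> 0\<close>.\<close>
  have "\<bar>g undefined x\<bar> \<le> C" by (rule bound) simp
  then have C: "C \<ge> 0" by linarith
  have "\<bar>f (p S) - f x\<bar> \<le> C * (real (card S) * norm (y - x))" for S
  proof (induction S rule: finite_induct[OF finite])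
    case 1
    have "p {} = x" by (simp add: p_def vec_eq_iff)
    then show ?case by simp
  next
    case (2 i S)
    define \<delta> where "\<delta> = y $ i - x $ i"
    have ins: "p (insert i S) = p S + \<delta> *\<^sub>R axis_dir i"
      using 2 by (auto simp: p_def vec_eq_iff \<delta>_def axis_dir_def axis_def)
    have near: "norm (p S + \<theta> *\<^sub>R axis_dir i - x) \<le> norm (y - x)" if "\<theta> \<in> closed_segment 0 \<delta>" for \<theta>
    proof (rule norm_le_componentwise_cart)
      fix j
      have "\<bar>\<theta>\<bar> \<le> \<bar>\<delta>\<bar>" using that by (auto simp: closed_segment_eq_real_ivl split: if_splits)
      then show "norm ((p S + \<theta> *\<^sub>R axis_dir i - x) $ j) \<le> norm ((y - x) $ j)"
        using 2 by (auto simp: p_def axis_dir_def axis_def \<delta>_def)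
    qed
    have d: "((\<lambda>\<theta>. f (p S + \<theta> *\<^sub>R axis_dir i)) has_real_derivative g i (p S + \<theta> *\<^sub>R axis_dir i)) (at \<theta>)"
      if "\<theta> \<in> closed_segment 0 \<delta>" for \<theta>
    proof -
      have "((\<lambda>h. f (p S + \<theta> *\<^sub>R axis_dir i + h *\<^sub>R axis_dir i)) has_real_derivative
          g i (p S + \<theta> *\<^sub>R axis_dir i)) (at 0)"
        using near[OF that] by (rule deriv)
      then have "((\<lambda>h. f (p S + (h + \<theta>) *\<^sub>R axis_dir i)) has_real_derivative
          g i (p S + \<theta> *\<^sub>R axis_dir i)) (at 0)"
        by (simp add: algebra_simps)
      then show ?thesis
        using DERIV_shift[of "\<lambda>\<theta>. f (p S + \<theta> *\<^sub>R axis_dir i)" _ 0 \<theta>] by (simp add: add.commute)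
    qed
    have "norm (f (p S + \<delta> *\<^sub>R axis_dir i) - f (p S + 0 *\<^sub>R axis_dir i)) \<le> C * norm (\<delta> - 0)"
      by (rule field_differentiable_bound[where S = "closed_segment 0 \<delta>" and f = "\<lambda>\<theta>. f (p S + \<theta> *\<^sub>R axis_dir i)"
          and f' = "\<lambda>\<theta>. g i (p S + \<theta> *\<^sub>R axis_dir i)"])
        (use d near bound in \<open>auto intro: has_field_derivative_at_within\<close>)
    also have "norm (\<delta> - 0) \<le> norm (y - x)"
      using component_le_norm_cart[of "y - x" i] by (simp add: \<delta>_def)
    finally have "\<bar>f (p (insert i S)) - f (p S)\<bar> \<le> C * norm (y - x)"
      using C by (simp add: ins mult_left_mono)
    moreover have "C * (real (card (insert i S)) * norm (y - x))
        = C * (real (card S) * norm (y - x)) + C * norm (y - x)"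
      using 2 by (simp add: algebra_simps)
    ultimately show ?case using 2 by linarith
  qed
  from this[of UNIV] show ?thesis by (simp add: p_def)
qed

lemma has_dx_deriv:
  "has_dx i u x t \<Longrightarrow> ((\<lambda>h. u (x + h *\<^sub>R axis_dir i) t) has_real_derivative dx i u x t) (at 0)"
  unfolding has_dx_def dx_def using DERIV_deriv_iff_real_differentiable by blast

lemma has_dt_deriv: "has_dt u x t \<Longrightarrow> ((\<lambda>\<tau>. u x \<tau>) has_real_derivative dt u x t) (at t)"
  unfolding has_dt_def dt_def using DERIV_deriv_iff_real_differentiable by blast

text \<open>All regularity classes of order above \<open>1/2\<close> reduce to this one, with \<open>a = 1\<close> for orders above \<open>1\<close>.
  No control of the gradient in time is asked for: at each fixed time the linear term cancels against
  the even kernel.\<close>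
definition c1_holder :: "real \<Rightarrow> (real^'n::finite) set \<Rightarrow> (real^'n \<Rightarrow> real \<Rightarrow> real) \<Rightarrow> bool" where
  "c1_holder a U v \<longleftrightarrow> (\<forall>x\<in>U. \<forall>i t. has_dx i v x t) \<and>
     (\<forall>x\<in>U. \<forall>t. \<exists>\<rho>>0. \<exists>C\<ge>0. cball x \<rho> \<subseteq> U \<and>
        (\<forall>y\<in>cball x \<rho>. \<forall>\<tau>\<in>{t-1..t+1}. \<bar>v y \<tau> - v y t\<bar> \<le> C * \<bar>\<tau> - t\<bar> powr a) \<and>
        (\<forall>y\<in>cball x \<rho>. \<forall>y'\<in>cball x \<rho>. \<forall>\<tau>\<in>{t-1..t+1}. \<forall>i.
            \<bar>dx i v y \<tau> - dx i v y' \<tau>\<bar> \<le> C * norm (y - y') powr (2 * a - 1)))"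

lemma c1_holderE:
  assumes "c1_holder a U v" "x \<in> U"
  obtains \<rho> C where "\<rho> > 0" "C \<ge> 0" "cball x \<rho> \<subseteq> U"
    "\<And>y \<tau>. y \<in> cball x \<rho> \<Longrightarrow> \<tau> \<in> {t-1..t+1} \<Longrightarrow> \<bar>v y \<tau> - v y t\<bar> \<le> C * \<bar>\<tau> - t\<bar> powr a"
    "\<And>y y' i \<tau>. y \<in> cball x \<rho> \<Longrightarrow> y' \<in> cball x \<rho> \<Longrightarrow> \<tau> \<in> {t-1..t+1} \<Longrightarrow>
        \<bar>dx i v y \<tau> - dx i v y' \<tau>\<bar> \<le> C * norm (y - y') powr (2 * a - 1)"
proof -
  have "\<exists>\<rho>>0. \<exists>C\<ge>0. cball x \<rho> \<subseteq> U \<and>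
        (\<forall>y\<in>cball x \<rho>. \<forall>\<tau>\<in>{t-1..t+1}. \<bar>v y \<tau> - v y t\<bar> \<le> C * \<bar>\<tau> - t\<bar> powr a) \<and>
        (\<forall>y\<in>cball x \<rho>. \<forall>y'\<in>cball x \<rho>. \<forall>\<tau>\<in>{t-1..t+1}. \<forall>i.
            \<bar>dx i v y \<tau> - dx i v y' \<tau>\<bar> \<le> C * norm (y - y') powr (2 * a - 1))"
    using assms unfolding c1_holder_def by simp
  then show ?thesis using that by (elim exE conjE) blast
qed

text \<open>The time increment is controlled uniformly in \<open>y\<close>, so it is enough to move
  in space at the single time \<open>t\<close>. There every partial derivative is bounded by its
  value at \<open>x\<close> plus its Hoelder oscillation; summing the values at \<open>x\<close>
  makes the bound \<open>D\<close> independent of the direction.\<close>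

lemma c1_holder_continuous:
  assumes v: "c1_holder a U v" and a: "1/2 < a" and U: "open U"
  shows "continuous_on (U \<times> UNIV) (\<lambda>p. v (fst p) (snd p))"
proof -
  have "isCont (\<lambda>p. v (fst p) (snd p)) (x, t)" if x: "x \<in> U" for x t
  proof -
    obtain \<rho> C where r: "\<rho> > 0" "C \<ge> 0" "cball x \<rho> \<subseteq> U"
      and T: "\<And>y \<tau>. y \<in> cball x \<rho> \<Longrightarrow> \<tau> \<in> {t-1..t+1} \<Longrightarrow> \<bar>v y \<tau> - v y t\<bar> \<le> C * \<bar>\<tau> - t\<bar> powr a"
      and X: "\<And>y y' i \<tau>. y \<in> cball x \<rho> \<Longrightarrow> y' \<in> cball x \<rho> \<Longrightarrow> \<tau> \<in> {t-1..t+1} \<Longrightarrow>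
          \<bar>dx i v y \<tau> - dx i v y' \<tau>\<bar> \<le> C * norm (y - y') powr (2 * a - 1)"
      by (rule c1_holderE[OF v x, where t = t]) (rule that)
    define D where "D = (\<Sum>i\<in>UNIV. \<bar>dx i v x t\<bar>) + C * \<rho> powr (2 * a - 1)"
    have S: "\<bar>v y t - v x t\<bar> \<le> D * (real CARD('a) * norm (y - x))" if y: "y \<in> cball x \<rho>" for y
    proof (rule partials_bounded_imp_diff_bound[where g = "\<lambda>i u. dx i v u t"])
      fix u i assume "norm (u - x) \<le> norm (y - x)"
      then have u: "u \<in> cball x \<rho>" using y by (simp add: dist_norm norm_minus_commute)
      show "((\<lambda>h. v (u + h *\<^sub>R axis_dir i) t) has_real_derivative dx i v u t) (at 0)"
        using v u r unfolding c1_holder_def by (intro has_dx_deriv) auto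
      have "\<bar>dx i v u t - dx i v x t\<bar> \<le> C * norm (u - x) powr (2 * a - 1)" using u r by (intro X) auto
      also have "\<dots> \<le> C * \<rho> powr (2 * a - 1)"
        using r a u by (intro mult_left_mono powr_mono2) (auto simp: dist_norm norm_minus_commute)
      finally have "\<bar>dx i v u t\<bar> \<le> \<bar>dx i v x t\<bar> + C * \<rho> powr (2 * a - 1)" by linarith
      also have "\<bar>dx i v x t\<bar> \<le> (\<Sum>i\<in>UNIV. \<bar>dx i v x t\<bar>)" by (rule member_le_sum) auto
      finally show "\<bar>dx i v u t\<bar> \<le> D" by (simp add: D_def)
    qed
    have "((\<lambda>p. v (fst p) (snd p)) \<longlongrightarrow> v x t) (at (x, t))"
    proof (rule Lim_transform_bound[where f = "\<lambda>p. v (fst p) (snd p) - v x t" and net = "at (x,t)", THEN Lim_null[THEN iffD2]])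
      have "\<forall>\<^sub>F p in nhds (x,t). p \<in> ball x \<rho> \<times> {t-1<..<t+1}"
        using r by (intro eventually_nhds_in_open open_Times) auto
      then have "\<forall>\<^sub>F p in at (x,t). p \<in> ball x \<rho> \<times> {t-1<..<t+1}"
        by (auto simp: eventually_at_filter elim: eventually_mono)
      then show "\<forall>\<^sub>F p in at (x,t). norm (v (fst p) (snd p) - v x t) \<le>
          norm (C * \<bar>snd p - t\<bar> powr a + D * (real CARD('a) * norm (fst p - x)))"
      proof eventually_elim
        case (elim p)
        then have "\<bar>v (fst p) (snd p) - v (fst p) t\<bar> \<le> C * \<bar>snd p - t\<bar> powr a"
          "\<bar>v (fst p) t - v x t\<bar> \<le> D * (real CARD('a) * norm (fst p - x))"
          by (auto intro!: T S)
        then show ?case by (smt (verit) real_norm_def)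
      qed
      have "((\<lambda>p. C * \<bar>snd p - t\<bar> powr a + D * (real CARD('a) * norm (fst p - x))) \<longlongrightarrow>
         C * \<bar>snd (x,t) - t\<bar> powr a + D * (real CARD('a) * norm (fst (x,t) - x))) (at (x,t))"
        using a by (intro tendsto_intros) (auto intro!: always_eventually)
      then show "((\<lambda>p. C * \<bar>snd p - t\<bar> powr a + D * (real CARD('a) * norm (fst p - x))) \<longlongrightarrow> 0) (at (x,t))"
        by simp
    qed
    then show ?thesis by (simp add: isCont_def)
  qed
  then show ?thesis by (auto intro!: continuous_at_imp_continuous_on)
qed

lemma compact_cylinder:
  fixes t :: real and x :: "real^'n::finite"
  shows "compact (cball x \<rho> \<times> {t-1..t+1})"
  by (intro compact_Times) auto

lemma par_holder_base_c1:
  assumes b: "par_holder_base a (U \<times> UNIV) v" and a: "1/2 < a" and U: "open U"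
  shows "c1_holder a U v"
  unfolding c1_holder_def
proof (intro conjI ballI allI)
  have not: "\<not> a \<le> 1/2" using a by simp
  show "has_dx i v x t" if "x \<in> U" for x i t
    using b that unfolding par_holder_base_def if_not_P[OF not] by auto
  fix x and t :: real assume "x \<in> U"
  then obtain \<rho> where r: "\<rho> > 0" "cball x \<rho> \<subseteq> U" using U open_contains_cball by blast
  then have "cball x \<rho> \<times> {t-1..t+1} \<subseteq> U \<times> UNIV" by auto
  then have "compact (cball x \<rho> \<times> {t-1..t+1}) \<and> cball x \<rho> \<times> {t-1..t+1} \<subseteq> U \<times> UNIV"
    using compact_cylinder by blast
  from b[unfolded par_holder_base_def if_not_P[OF not], THEN conjunct2, rule_format, OF this]
  obtain C where C:
    "\<And>x' t' \<tau>. (x', t') \<in> cball x \<rho> \<times> {t-1..t+1} \<Longrightarrow> (x', \<tau>) \<in> cball x \<rho> \<times> {t-1..t+1} \<Longrightarrow>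
       \<bar>v x' t' - v x' \<tau>\<bar> \<le> C * \<bar>t' - \<tau>\<bar> powr a"
    "\<And>i x' y t'. (x', t') \<in> cball x \<rho> \<times> {t-1..t+1} \<Longrightarrow> (y, t') \<in> cball x \<rho> \<times> {t-1..t+1} \<Longrightarrow>
       \<bar>dx i v x' t' - dx i v y t'\<bar> \<le> C * norm (x' - y) powr (2 * a - 1)"
    by (elim exE conjE) blast
  \<comment> \<open>The constant in the regularity class carries no sign condition, so it is
    replaced by its positive part.\<close>
  have C': "C * q powr b \<le> max C 0 * q powr b" for q b by (intro mult_right_mono) auto
  show "\<exists>\<rho>>0. \<exists>C\<ge>0. cball x \<rho> \<subseteq> U \<and>
        (\<forall>y\<in>cball x \<rho>. \<forall>\<tau>\<in>{t-1..t+1}. \<bar>v y \<tau> - v y t\<bar> \<le> C * \<bar>\<tau> - t\<bar> powr a) \<and>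
        (\<forall>y\<in>cball x \<rho>. \<forall>y'\<in>cball x \<rho>. \<forall>\<tau>\<in>{t-1..t+1}. \<forall>i.
            \<bar>dx i v y \<tau> - dx i v y' \<tau>\<bar> \<le> C * norm (y - y') powr (2 * a - 1))"
  proof (rule exI[of _ \<rho>], intro conjI r, rule exI[of _ "max C 0"], intro conjI ballI allI r)
    show "\<bar>v y \<tau> - v y t\<bar> \<le> max C 0 * \<bar>\<tau> - t\<bar> powr a" if "y \<in> cball x \<rho>" "\<tau> \<in> {t-1..t+1}" for y \<tau>
      using that C' by (intro order_trans[OF C(1) C']) auto
    show "\<bar>dx i v y \<tau> - dx i v y' \<tau>\<bar> \<le> max C 0 * norm (y - y') powr (2 * a - 1)"
      if "y \<in> cball x \<rho>" "y' \<in> cball x \<rho>" "\<tau> \<in> {t-1..t+1}" for y y' i \<tau>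
      using that C' by (intro order_trans[OF C(2) C']) auto
  qed simp
qed

text \<open>Continuous derivatives are bounded on compact cylinders. A bounded time derivative makes
  \<open>v\<close> Lipschitz in time, and bounded second derivatives make the gradient Lipschitz in
  space; these are the exponents a and 2a - 1 at a = 1.\<close>

lemma C2_imp_c1_holder:
  fixes v :: "real^'n::finite \<Rightarrow> real \<Rightarrow> real"
  assumes d: "\<And>x t. x \<in> U \<Longrightarrow> has_dt v x t" "\<And>x t i. x \<in> U \<Longrightarrow> has_dx i v x t"
     "\<And>x t i j. x \<in> U \<Longrightarrow> has_dx i (dx j v) x t"
    and c: "continuous_on (U \<times> UNIV) (\<lambda>p. dt v (fst p) (snd p))"
     "\<And>i j. continuous_on (U \<times> UNIV) (\<lambda>p. dx i (dx j v) (fst p) (snd p))"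
    and U: "open U"
  shows "c1_holder 1 U v"
  unfolding c1_holder_def
proof (intro conjI ballI allI)
  show "has_dx i v x t" if "x \<in> U" for x i t using d that by auto
  fix x and t :: real assume "x \<in> U"
  then obtain \<rho> where r: "\<rho> > 0" "cball x \<rho> \<subseteq> U" using U open_contains_cball by blast
  define K where "K = cball x \<rho> \<times> {t-1..t+1}"
  have K: "compact K" "K \<subseteq> U \<times> UNIV" using r compact_cylinder[of x \<rho> t] by (auto simp: K_def)
  have bd: "\<exists>B\<ge>0. \<forall>p\<in>K. \<bar>f p\<bar> \<le> B" if "continuous_on (U \<times> UNIV) f" for f :: "_ \<Rightarrow> real"
  proof -
    have "compact (f ` K)" using that K by (meson compact_continuous_image continuous_on_subset)
    then have "bounded (f ` K)" by (rule compact_imp_bounded)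
    then obtain B where "\<forall>y\<in>f ` K. norm y \<le> B" unfolding bounded_iff by blast
    then show ?thesis by (intro exI[of _ "max B 0"]) (auto simp: le_max_iff_disj)
  qed
  obtain B where B: "B \<ge> 0" "\<And>y \<tau>. y \<in> cball x \<rho> \<Longrightarrow> \<tau> \<in> {t-1..t+1} \<Longrightarrow> \<bar>dt v y \<tau>\<bar> \<le> B"
    using bd[OF c(1)] unfolding K_def by fastforce
  obtain D where D: "\<And>i j. D i j \<ge> 0"
    "\<And>i j y \<tau>. y \<in> cball x \<rho> \<Longrightarrow> \<tau> \<in> {t-1..t+1} \<Longrightarrow> \<bar>dx i (dx j v) y \<tau>\<bar> \<le> D i j"
  proof -
    have "\<forall>i j. \<exists>B\<ge>0. \<forall>p\<in>K. \<bar>dx i (dx j v) (fst p) (snd p)\<bar> \<le> B" using bd[OF c(2)] by blast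
    then obtain D where "\<forall>i j. 0 \<le> D i j \<and> (\<forall>p\<in>K. \<bar>dx i (dx j v) (fst p) (snd p)\<bar> \<le> D i j)" by metis
    then show ?thesis by (intro that[of D]) (auto simp: K_def)
  qed
  define E where "E = (\<Sum>i\<in>UNIV. \<Sum>j\<in>UNIV. D i j)"
  have DE: "D i j \<le> E" for i j
  proof -
    have "D i j \<le> (\<Sum>j\<in>UNIV. D i j)" using D by (intro member_le_sum) auto
    also have "\<dots> \<le> E" unfolding E_def by (intro member_le_sum[of i UNIV "\<lambda>i. \<Sum>j\<in>UNIV. D i j"]) (auto intro: sum_nonneg D)
    finally show ?thesis .
  qed
  have E0: "E \<ge> 0" unfolding E_def by (intro sum_nonneg D)
  define C where "C = B + E * real CARD('n)"
  have C: "B \<le> C" "E * real CARD('n) \<le> C" "C \<ge> 0" using B E0 by (auto simp: C_def)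
  show "\<exists>\<rho>>0. \<exists>C\<ge>0. cball x \<rho> \<subseteq> U \<and>
        (\<forall>y\<in>cball x \<rho>. \<forall>\<tau>\<in>{t-1..t+1}. \<bar>v y \<tau> - v y t\<bar> \<le> C * \<bar>\<tau> - t\<bar> powr 1) \<and>
        (\<forall>y\<in>cball x \<rho>. \<forall>y'\<in>cball x \<rho>. \<forall>\<tau>\<in>{t-1..t+1}. \<forall>i.
            \<bar>dx i v y \<tau> - dx i v y' \<tau>\<bar> \<le> C * norm (y - y') powr (2 * 1 - 1))"
  proof (rule exI[of _ "\<rho> / 3"], intro conjI, use r in simp, rule exI[of _ C], intro conjI ballI allI)
    \<comment> \<open>Two points of the ball of radius \<rho>/3 are at most 2\<rho>/3 apart, so the
      coordinate path joining them stays within \<rho> of \<open>x\<close>.\<close>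
    show "cball x (\<rho> / 3) \<subseteq> U" using r by (auto simp: subset_iff)
    show "\<bar>v y \<tau> - v y t\<bar> \<le> C * \<bar>\<tau> - t\<bar> powr 1" if "y \<in> cball x (\<rho> / 3)" "\<tau> \<in> {t-1..t+1}" for y \<tau>
    proof -
      have y: "y \<in> cball x \<rho>" using that r by auto
      have "norm (v y \<tau> - v y t) \<le> B * norm (\<tau> - t)"
        by (rule field_differentiable_bound[where S = "{t-1..t+1}" and f' = "dt v y"])
          (use y r B that in \<open>auto intro!: has_field_derivative_at_within[OF has_dt_deriv] d(1)\<close>)
      also have "\<dots> \<le> C * \<bar>\<tau> - t\<bar>" using C by (simp add: mult_right_mono)
      finally show ?thesis by simp
    qed
    show "\<bar>dx i v y \<tau> - dx i v y' \<tau>\<bar> \<le> C * norm (y - y') powr (2 * 1 - 1)"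
      if y: "y \<in> cball x (\<rho> / 3)" "y' \<in> cball x (\<rho> / 3)" and \<tau>: "\<tau> \<in> {t-1..t+1}" for y y' i \<tau>
    proof -
      have "\<bar>dx i v y \<tau> - dx i v y' \<tau>\<bar> \<le> E * (real CARD('n) * norm (y - y'))"
      proof (rule partials_bounded_imp_diff_bound[where g = "\<lambda>j u. dx j (dx i v) u \<tau>"])
        fix u j assume "norm (u - y') \<le> norm (y - y')"
        then have "dist u y' \<le> dist y y'" by (simp add: dist_norm)
        also have "\<dots> \<le> dist x y + dist x y'" by (metis dist_commute dist_triangle)
        also have "\<dots> \<le> 2 * \<rho> / 3" using y by simp
        finally have u: "u \<in> cball x \<rho>" using y dist_triangle[of x u y'] by (simp add: dist_commute)
        show "((\<lambda>h. dx i v (u + h *\<^sub>R axis_dir j) \<tau>) has_real_derivative dx j (dx i v) u \<tau>) (at 0)"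
          using u r by (intro has_dx_deriv d) auto
        show "\<bar>dx j (dx i v) u \<tau>\<bar> \<le> E" using D(2)[OF u \<tau>] DE order_trans by blast
      qed
      also have "\<dots> \<le> C * norm (y - y')" using C by (simp add: mult_right_mono flip: mult.assoc)
      finally show ?thesis by simp
    qed
  qed (use C in simp)
qed

section \<open>Orders up to one half, and the reduction of all orders to second differences\<close>

lemma par_holder_base_low:
  assumes b: "par_holder_base a (U \<times> UNIV) v" and a: "a \<le> 1/2" and U: "open U" and x: "x \<in> U"
  obtains \<rho> C where "\<rho> > 0" "C \<ge> 0" "cball x \<rho> \<subseteq> U"
    "\<And>y \<tau>. y \<in> cball x \<rho> \<Longrightarrow> \<tau> \<in> {t-1..t+1} \<Longrightarrow>
       \<bar>v x t - v y \<tau>\<bar> \<le> C * (norm (x - y) + sqrt \<bar>t - \<tau>\<bar>) powr (2 * a)"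
proof -
  obtain \<rho> where r: "\<rho> > 0" "cball x \<rho> \<subseteq> U" using U x open_contains_cball by blast
  then have K: "cball x \<rho> \<times> {t-1..t+1} \<subseteq> U \<times> UNIV" by auto
  have "\<exists>C. \<forall>x' t' y \<tau>. (x',t') \<in> cball x \<rho> \<times> {t-1..t+1} \<and> (y,\<tau>) \<in> cball x \<rho> \<times> {t-1..t+1} \<longrightarrow>
           \<bar>v x' t' - v y \<tau>\<bar> \<le> C * (norm (x' - y) + sqrt \<bar>t' - \<tau>\<bar>) powr (2 * a)"
    using b compact_cylinder[of x \<rho> t] K unfolding par_holder_base_def if_P[OF a] by blast
  then obtain C where C0: "\<forall>x' t' y \<tau>. (x',t') \<in> cball x \<rho> \<times> {t-1..t+1} \<and> (y,\<tau>) \<in> cball x \<rho> \<times> {t-1..t+1} \<longrightarrow>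
           \<bar>v x' t' - v y \<tau>\<bar> \<le> C * (norm (x' - y) + sqrt \<bar>t' - \<tau>\<bar>) powr (2 * a)" ..
  have C: "\<bar>v x t - v y \<tau>\<bar> \<le> C * (norm (x - y) + sqrt \<bar>t - \<tau>\<bar>) powr (2 * a)"
    if "(y,\<tau>) \<in> cball x \<rho> \<times> {t-1..t+1}" for y \<tau>
    using C0[rule_format, of x t y \<tau>] that r by auto
  have C': "C * q powr b \<le> max C 0 * q powr b" for q b by (intro mult_right_mono) auto
  show ?thesis
    by (rule that[of \<rho> "max C 0"]) (use r in \<open>auto intro!: order_trans[OF C C']\<close>)
qed

lemma par_holder_base_low_continuous:
  assumes b: "par_holder_base a (U \<times> UNIV) v" and a: "0 < a" "a \<le> 1/2" and U: "open U"
  shows "continuous_on (U \<times> UNIV) (\<lambda>p. v (fst p) (snd p))"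
proof -
  have "isCont (\<lambda>p. v (fst p) (snd p)) (x, t)" if x: "x \<in> U" for x t
  proof -
    obtain \<rho> C where r: "\<rho> > 0" "C \<ge> 0" "cball x \<rho> \<subseteq> U" and T:
      "\<And>y \<tau>. y \<in> cball x \<rho> \<Longrightarrow> \<tau> \<in> {t-1..t+1} \<Longrightarrow>
       \<bar>v x t - v y \<tau>\<bar> \<le> C * (norm (x - y) + sqrt \<bar>t - \<tau>\<bar>) powr (2 * a)"
      by (rule par_holder_base_low[OF b a(2) U x, where t = t]) (rule that)
    have "((\<lambda>p. v (fst p) (snd p)) \<longlongrightarrow> v x t) (at (x, t))"
    proof (rule Lim_transform_bound[where f = "\<lambda>p. v (fst p) (snd p) - v x t" and net = "at (x,t)", THEN Lim_null[THEN iffD2]])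
      have "\<forall>\<^sub>F p in nhds (x,t). p \<in> ball x \<rho> \<times> {t-1<..<t+1}"
        using r by (intro eventually_nhds_in_open open_Times) auto
      then have "\<forall>\<^sub>F p in at (x,t). p \<in> ball x \<rho> \<times> {t-1<..<t+1}"
        by (auto simp: eventually_at_filter elim: eventually_mono)
      then show "\<forall>\<^sub>F p in at (x,t). norm (v (fst p) (snd p) - v x t) \<le>
          norm (C * (norm (x - fst p) + sqrt \<bar>t - snd p\<bar>) powr (2 * a))"
      proof eventually_elim
        case (elim p)
        then have "\<bar>v x t - v (fst p) (snd p)\<bar> \<le> C * (norm (x - fst p) + sqrt \<bar>t - snd p\<bar>) powr (2 * a)"
          by (intro T) auto
        then show ?case by (smt (verit) real_norm_def)
      qed
      have "((\<lambda>p. C * (norm (x - fst p) + sqrt \<bar>t - snd p\<bar>) powr (2 * a)) \<longlongrightarrow>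
         C * (norm (x - fst (x,t)) + sqrt \<bar>t - snd (x,t)\<bar>) powr (2 * a)) (at (x,t))"
        using a by (intro tendsto_intros) (auto intro!: always_eventually)
      then show "((\<lambda>p. C * (norm (x - fst p) + sqrt \<bar>t - snd p\<bar>) powr (2 * a)) \<longlongrightarrow> 0) (at (x,t))"
        by simp
    qed
    then show ?thesis by (simp add: isCont_def)
  qed
  then show ?thesis by (auto intro!: continuous_at_imp_continuous_on)
qed

text \<open>One induction on the fuel serves both conclusions. For order above 1 the induction
  hypothesis, at order \<open>a - 1\<close>, supplies the continuity of the time derivative and of
  the second space derivatives; these give the class with exponent 1, which in turn gives continuity
  of \<open>v\<close> itself.\<close>

lemma par_holder_fuel_continuous:
  assumes "par_holder_fuel k a (U \<times> UNIV) v" and "0 < a" and U: "open U"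
  shows "continuous_on (U \<times> UNIV) (\<lambda>p. v (fst p) (snd p))"
    and "1 < a \<Longrightarrow> c1_holder 1 U v"
proof -
  have base: "continuous_on (U \<times> UNIV) (\<lambda>p. v (fst p) (snd p))"
    if "par_holder_base a (U \<times> UNIV) v" "0 < a" for a v
    using par_holder_base_low_continuous[OF that(1) that(2) _ U]
      c1_holder_continuous[OF par_holder_base_c1[OF that(1) _ U] _ U]
    by (cases "a \<le> 1/2") auto
  have "continuous_on (U \<times> UNIV) (\<lambda>p. v (fst p) (snd p)) \<and> (1 < a \<longrightarrow> c1_holder 1 U v)"
    using assms(1,2)
  proof (induction k arbitrary: a v)
    case 0
    then show ?case using base by auto
  next
    case (Suc k)
    show ?case
    proof (cases "a \<le> 1")
      case True
      then show ?thesis using Suc base by auto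
    next
      case False
      then have "c1_holder 1 U v"
        using Suc.prems(1) Suc.IH[of "a - 1"] by (intro C2_imp_c1_holder U) auto
      then show ?thesis using c1_holder_continuous U by fastforce
    qed
  qed
  then show "continuous_on (U \<times> UNIV) (\<lambda>p. v (fst p) (snd p))" "1 < a \<Longrightarrow> c1_holder 1 U v" by auto
qed

text \<open>The difference splits into the time increment at \<open>x\<close>, taken twice, and the
  spatial increment at the fixed time t - h of the even function \<phi>(u) = v(x+u) + v(x-u). The
  partial derivatives of \<phi> are differences of those of \<open>v\<close> at x + u and x - u,
  hence of size |u|^(2a-1), and integrating along a path from 0 to \<open>z\<close> gives
  |z|^(2a).\<close>

lemma c1_holder_second_difference:
  fixes v :: "real^'n::finite \<Rightarrow> real \<Rightarrow> real" and t :: real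
  assumes v: "c1_holder a U v" and a: "1/2 < a" "a \<le> 1" and U: "open U" and x: "x \<in> U"
  shows "\<exists>\<rho>>0. \<exists>C\<ge>0. cball x \<rho> \<subseteq> U \<and> (\<forall>z h. norm z \<le> \<rho> \<longrightarrow> 0 \<le> h \<longrightarrow> h \<le> 1 \<longrightarrow>
           \<bar>2 * v x t - v (x + z) (t - h) - v (x - z) (t - h)\<bar> \<le> C * (norm z + sqrt h) powr (2 * a))"
proof -
  obtain \<rho> C where r: "\<rho> > 0" "C \<ge> 0" "cball x \<rho> \<subseteq> U"
    and T: "\<And>y \<tau>. y \<in> cball x \<rho> \<Longrightarrow> \<tau> \<in> {t-1..t+1} \<Longrightarrow> \<bar>v y \<tau> - v y t\<bar> \<le> C * \<bar>\<tau> - t\<bar> powr a"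
    and X: "\<And>y y' i \<tau>. y \<in> cball x \<rho> \<Longrightarrow> y' \<in> cball x \<rho> \<Longrightarrow> \<tau> \<in> {t-1..t+1} \<Longrightarrow>
        \<bar>dx i v y \<tau> - dx i v y' \<tau>\<bar> \<le> C * norm (y - y') powr (2 * a - 1)"
    by (rule c1_holderE[OF v x, where t = t]) (rule that)
  define N where "N = real CARD('n)"
  define C' where "C' = 2 * C + C * 2 * N"
  have C': "C' \<ge> 0" using r by (simp add: C'_def N_def)
  have "\<bar>2 * v x t - v (x + z) (t - h) - v (x - z) (t - h)\<bar> \<le> C' * (norm z + sqrt h) powr (2 * a)"
    if z: "norm z \<le> \<rho>" and h: "0 \<le> h" "h \<le> 1" for z h
  proof -
    define \<phi> where "\<phi> = (\<lambda>u. v (x + u) (t - h) + v (x - u) (t - h))"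
    have 1: "\<bar>v x (t - h) - v x t\<bar> \<le> C * h powr a" using T[of x "t - h"] r h by auto
    have "\<bar>\<phi> z - \<phi> 0\<bar> \<le> (C * (2 * norm z) powr (2 * a - 1)) * (real CARD('n) * norm (z - 0))"
    proof (rule partials_bounded_imp_diff_bound[where g = "\<lambda>i u. dx i v (x + u) (t - h) - dx i v (x - u) (t - h)"])
      fix u :: "real^'n" and i assume u: "norm (u - 0) \<le> norm (z - 0)"
      then have u': "x + u \<in> cball x \<rho>" "x - u \<in> cball x \<rho>" using z by (auto simp: dist_norm)
      then have "x + u \<in> U" "x - u \<in> U" using r by auto
      then have d: "((\<lambda>k. v (x + u + k *\<^sub>R axis_dir i) (t - h)) has_real_derivative dx i v (x + u) (t - h)) (at 0)"
        "((\<lambda>k. v (x - u + k *\<^sub>R axis_dir i) (t - h)) has_real_derivative dx i v (x - u) (t - h)) (at (- (0::real)))"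
        using v unfolding c1_holder_def minus_zero by (blast intro: has_dx_deriv)+
      \<comment> \<open>The term x - u moves against the axis direction. Its derivative was recorded
        at \<open>- 0\<close> to fit the shape of \<open>DERIV_mirror\<close>.\<close>
      have "((\<lambda>k. v (x - u + (- k) *\<^sub>R axis_dir i) (t - h)) has_real_derivative - dx i v (x - u) (t - h)) (at 0)"
        using d(2) DERIV_mirror[of "\<lambda>k. v (x - u + k *\<^sub>R axis_dir i) (t - h)" _ "0"] by simp
      from DERIV_add[OF d(1) this]
      show "((\<lambda>k. \<phi> (u + k *\<^sub>R axis_dir i)) has_real_derivative dx i v (x + u) (t - h) - dx i v (x - u) (t - h)) (at 0)"
        by (simp add: \<phi>_def algebra_simps)
      have "\<bar>dx i v (x + u) (t - h) - dx i v (x - u) (t - h)\<bar> \<le> C * norm ((x + u) - (x - u)) powr (2 * a - 1)"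
        using u' h by (intro X) auto
      also have "(x + u) - (x - u) = 2 *\<^sub>R u" by (simp add: scaleR_2)
      also have "C * norm (2 *\<^sub>R u) powr (2 * a - 1) \<le> C * (2 * norm z) powr (2 * a - 1)"
        using r a u by (intro mult_left_mono powr_mono2) auto
      finally show "\<bar>dx i v (x + u) (t - h) - dx i v (x - u) (t - h)\<bar> \<le> C * (2 * norm z) powr (2 * a - 1)" .
    qed
    also have "\<dots> = C * N * ((2 * norm z) powr (2 * a - 1) * norm z)" by (simp add: N_def)
    also have "(2 * norm z) powr (2 * a - 1) * norm z \<le> 2 * norm z powr (2 * a)"
    proof -
      have "norm z powr (2 * a - 1) * norm z = norm z powr (2 * a)"
        using a by (cases "norm z = 0") (auto simp: powr_diff)
      moreover have "2 powr (2 * a - 1) \<le> (2::real) powr 1" using a by (intro powr_mono) auto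
      ultimately show ?thesis by (simp add: powr_mult mult.assoc mult_right_mono)
    qed
    also have "norm z powr (2 * a) \<le> (norm z + sqrt h) powr (2 * a)" using a h by (intro powr_mono2) auto
    finally have 2: "\<bar>\<phi> z - \<phi> 0\<bar> \<le> C * N * (2 * (norm z + sqrt h) powr (2 * a))"
      using r by (simp add: N_def mult_left_mono)
    have "h powr a = sqrt h powr (2 * a)" using h by (simp add: powr_half_sqrt[symmetric] powr_powr)
    also have "\<dots> \<le> (norm z + sqrt h) powr (2 * a)" using a h by (intro powr_mono2) auto
    finally have "C * h powr a \<le> C * (norm z + sqrt h) powr (2 * a)" using r by (intro mult_left_mono)
    with 1 2 show ?thesis by (auto simp: \<phi>_def C'_def algebra_simps abs_le_iff)
  qed
  then show ?thesis using r C' by blast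
qed

text \<open>The common outcome of the three ranges of the order, with \<open>a\<close> the minimum
  of \<open>b\<close> and 1. For \<open>b \<le> 1/2\<close> two first differences suffice, without
  cancellation. The inequality \<open>s < a\<close> will make h^(a-1-s) integrable at h = 0.\<close>

lemma par_holder_loc_regularity:
  fixes w :: "real^'n::finite \<Rightarrow> real \<Rightarrow> real"
  assumes w: "par_holder_loc b (U \<times> UNIV) w" and s: "0 < s" "s < 1" "s < b" and U: "open U"
  shows "continuous_on (U \<times> UNIV) (\<lambda>p. w (fst p) (snd p))"
    and "\<exists>a. s < a \<and> a \<le> 1 \<and> (\<forall>x\<in>U. \<forall>t. \<exists>\<rho>>0. \<exists>C\<ge>0. cball x \<rho> \<subseteq> U \<and>
       (\<forall>z h. norm z \<le> \<rho> \<longrightarrow> 0 \<le> h \<longrightarrow> h \<le> 1 \<longrightarrow>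
           \<bar>2 * w x t - w (x + z) (t - h) - w (x - z) (t - h)\<bar> \<le> C * (norm z + sqrt h) powr (2 * a)))"
proof -
  have b0: "0 < b" and fuel: "par_holder_fuel (nat \<lceil>b\<rceil>) b (U \<times> UNIV) w"
    using w unfolding par_holder_loc_def by auto
  show "continuous_on (U \<times> UNIV) (\<lambda>p. w (fst p) (snd p))"
    using par_holder_fuel_continuous(1)[OF fuel b0 U] .
  have base: "par_holder_base b (U \<times> UNIV) w" if "b \<le> 1"
    using fuel that by (cases "nat \<lceil>b\<rceil>") auto
  consider "b \<le> 1/2" | "1/2 < b" "b \<le> 1" | "1 < b" by linarith
  then show "\<exists>a. s < a \<and> a \<le> 1 \<and> (\<forall>x\<in>U. \<forall>t. \<exists>\<rho>>0. \<exists>C\<ge>0. cball x \<rho> \<subseteq> U \<and>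
       (\<forall>z h. norm z \<le> \<rho> \<longrightarrow> 0 \<le> h \<longrightarrow> h \<le> 1 \<longrightarrow>
           \<bar>2 * w x t - w (x + z) (t - h) - w (x - z) (t - h)\<bar> \<le> C * (norm z + sqrt h) powr (2 * a)))"
  proof cases
    case 1
    have "\<exists>\<rho>>0. \<exists>C\<ge>0. cball x \<rho> \<subseteq> U \<and>
       (\<forall>z h. norm z \<le> \<rho> \<longrightarrow> 0 \<le> h \<longrightarrow> h \<le> 1 \<longrightarrow>
           \<bar>2 * w x t - w (x + z) (t - h) - w (x - z) (t - h)\<bar> \<le> C * (norm z + sqrt h) powr (2 * b))"
      if xU: "x \<in> U" for x t
    proof -
      obtain \<rho> C where r: "\<rho> > 0" "C \<ge> 0" "cball x \<rho> \<subseteq> U" and T: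
        "\<And>y \<tau>. y \<in> cball x \<rho> \<Longrightarrow> \<tau> \<in> {t-1..t+1} \<Longrightarrow>
         \<bar>w x t - w y \<tau>\<bar> \<le> C * (norm (x - y) + sqrt \<bar>t - \<tau>\<bar>) powr (2 * b)"
        by (rule par_holder_base_low[OF base 1 U xU, where t = t]) (use 1 that in auto)
      have "\<bar>2 * w x t - w (x + z) (t - h) - w (x - z) (t - h)\<bar> \<le> (2 * C) * (norm z + sqrt h) powr (2 * b)"
        if "norm z \<le> \<rho>" "0 \<le> h" "h \<le> 1" for z h
        using T[of "x + z" "t - h"] T[of "x - z" "t - h"] that by (auto simp: dist_norm abs_le_iff)
      then show ?thesis using r by (intro exI[of _ \<rho>] conjI exI[of _ "2 * C"]) auto
    qed
    then show ?thesis using 1 s by (intro exI[of _ b]) auto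
  next
    case 2
    then show ?thesis using s c1_holder_second_difference[OF par_holder_base_c1[OF base _ U] _ _ U]
      by (intro exI[of _ b]) auto
  next
    case 3
    then show ?thesis using s c1_holder_second_difference[OF par_holder_fuel_continuous(2)[OF fuel b0 U] _ _ U]
      by (intro exI[of _ 1]) auto
  qed
qed

section \<open>Integrability away from the singularity\<close>

text \<open>Joint measurability is extracted from local integrability: \<open>u\<close> is the
  pointwise limit of its truncations to growing balls.\<close>

lemma space_L_measurable:
  fixes u :: "real^'n::finite \<Rightarrow> real \<Rightarrow> real"
  assumes "u \<in> space_L s"
  shows "(\<lambda>p. u (fst p) (snd p)) \<in> borel_measurable borel"
proof (rule borel_measurable_LIMSEQ_real)
  fix k :: nat
  have "set_integrable lborel (cball 0 (real k)) (\<lambda>p::(real^'n) \<times> real. u (fst p) (snd p))"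
    using assms by (auto simp: space_L_def)
  then show "(\<lambda>p. indicator (cball 0 (real k)) p * u (fst p) (snd p)) \<in> borel_measurable borel"
    unfolding set_integrable_def by auto
next
  fix p :: "(real^'n) \<times> real"
  obtain m :: nat where m: "norm p \<le> real m" using real_arch_simple by blast
  have "\<forall>\<^sub>F k in sequentially. indicator (cball 0 (real k)) p * u (fst p) (snd p) = u (fst p) (snd p)"
    using eventually_ge_at_top[of m]
  proof eventually_elim
    case (elim k)
    then have "norm p \<le> real k" using m by linarith
    then show ?case by (simp add: indicator_def)
  qed
  then show "(\<lambda>k. indicator (cball 0 (real k)) p * u (fst p) (snd p)) \<longlonglongrightarrow> u (fst p) (snd p)"
    by (rule tendsto_eventually)
qed

text \<open>The exponents compare by |y|^2/b \<le> |x|^2/(b-a) + |x-y|^2/a, a form of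
  Cauchy-Schwarz. Widening the Gaussian from \<open>a\<close> to \<open>b\<close> pays for moving
  its centre from \<open>x\<close> to the origin, where the weight of \<open>space_L\<close> is
  centred.\<close>

lemma gaussian_recenter:
  fixes x y :: "real^'n::finite"
  assumes "0 < a" "a < b"
  shows "exp (- (norm (x - y))\<^sup>2 / (4 * a)) \<le> exp ((norm x)\<^sup>2 / (4 * (b - a))) * exp (- (norm y)\<^sup>2 / (4 * b))"
proof -
  define X Z where "X = norm x" and "Z = norm (x - y)"
  have "norm y \<le> X + Z" unfolding X_def Z_def using norm_triangle_ineq4[of x "x - y"] by simp
  then have "(norm y)\<^sup>2 / b \<le> (X + Z)\<^sup>2 / b" using assms by (intro divide_right_mono power_mono) auto
  also have "\<dots> \<le> X\<^sup>2 / (b - a) + Z\<^sup>2 / a"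
  proof -
    have "X\<^sup>2 / (b - a) + Z\<^sup>2 / a - (X + Z)\<^sup>2 / b = (a * X - (b - a) * Z)\<^sup>2 / (a * (b - a) * b)"
      using assms by (simp add: field_simps power2_eq_square)
    also have "\<dots> \<ge> 0" using assms by auto
    finally show ?thesis by simp
  qed
  finally have "((norm y)\<^sup>2 / b) / 4 \<le> (X\<^sup>2 / (b - a) + Z\<^sup>2 / a) / 4" by simp
  then have "- (Z\<^sup>2 / a / 4) \<le> X\<^sup>2 / (b - a) / 4 + - ((norm y)\<^sup>2 / b / 4)"
    unfolding add_divide_distrib by linarith
  then show ?thesis unfolding exp_add[symmetric] exp_le_cancel_iff X_def Z_def
    by (simp add: mult.commute[of 4])
qed

lemma powr_le_exp:
  fixes q m :: real
  assumes "q \<ge> 0" "m > 0"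
  shows "q powr m \<le> m powr m * exp q"
proof -
  have "q / m \<le> exp (q / m)" using exp_ge_add_one_self[of "q / m"] by linarith
  then have "(q / m) powr m \<le> exp (q / m) powr m" using assms by (intro powr_mono2) auto
  also have "exp (q / m) powr m = exp q" using assms by (simp add: powr_def)
  finally show ?thesis using assms by (simp add: powr_divide field_simps)
qed

text \<open>Constants have finite weight, which takes care of the term \<open>u x t\<close> in the
  integrand. The spatial integral is (4 pi h)^(n/2) / (1 + h^m) with h = t - \<tau> and m = n/2 + 1
  + s; dropping the power for h < 1 and the 1 for h \<ge> 1 leaves h^(n/2) and h^(-1-s).\<close>

lemma integrable_space_L_kernel:
  assumes s: "0 < s"
  shows "integrable lborel (\<lambda>p::(real^'n::finite) \<times> real. indicator {p. snd p < t} p *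
           (exp (- (norm (fst p))\<^sup>2 / (4 * (t - snd p))) / (1 + (t - snd p) powr (real CARD('n) / 2 + 1 + s))))"
    (is "integrable _ ?L")
proof -
  define n where "n = real CARD('n)"
  define m where "m = n / 2 + 1 + s"
  have [measurable]: "?L \<in> borel_measurable (lborel \<Otimes>\<^sub>M lborel)" by measurable
  have L: "?L (y, \<tau>) = indicator {..<t} \<tau> / (1 + (t - \<tau>) powr m) * exp (- (norm (0 - y))\<^sup>2 / (4 * (t - \<tau>)))"
    for y and \<tau> :: real by (auto simp: indicator_def m_def n_def)
  have inner: "integrable lborel (\<lambda>y. ?L (y, \<tau>))"
    "(LINT y|lborel. norm (?L (y, \<tau>))) = indicator {..<t} \<tau> / (1 + (t - \<tau>) powr m) * (pi * (4 * (t - \<tau>))) powr (n / 2)" for \<tau>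
  proof -
    show "integrable lborel (\<lambda>y. ?L (y, \<tau>))" unfolding L
    proof (cases "\<tau> < t")
      case True
      then show "integrable lborel (\<lambda>y::real^'n. indicator {..<t} \<tau> / (1 + (t - \<tau>) powr m) * exp (- (norm (0 - y))\<^sup>2 / (4 * (t - \<tau>))))"
        by (intro integrable_mult_right gaussian_integral_at) auto
    qed simp
    have "norm (?L (y, \<tau>)) = ?L (y, \<tau>)" for y by (auto simp: indicator_def)
    then show "(LINT y|lborel. norm (?L (y, \<tau>))) = indicator {..<t} \<tau> / (1 + (t - \<tau>) powr m) * (pi * (4 * (t - \<tau>))) powr (n / 2)"
      unfolding L using gaussian_integral_at(2)[of "4 * (t - \<tau>)" "0::real^'n"]
      by (cases "\<tau> < t") (simp_all add: n_def del: diff_0)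
  qed
  have "integrable lborel (\<lambda>\<tau>. (4 * pi) powr (n / 2) *
      (indicator {t - 1..<t} \<tau> * (t - \<tau>) powr (n / 2) + indicator {..t - 1} \<tau> * (t - \<tau>) powr (- 1 - s)))"
    using has_bochner_integral_powr_near[of "n / 2" 1 t] has_bochner_integral_powr_far[of "-1 - s" 1 t] s
    by (auto simp: has_bochner_integral_iff n_def)
  then have outer: "integrable lborel (\<lambda>\<tau>. LINT y|lborel. norm (?L (y, \<tau>)))"
  proof (rule Bochner_Integration.integrable_bound)
    show "AE \<tau> in lborel. norm (LINT y|lborel. norm (?L (y, \<tau>))) \<le> norm ((4 * pi) powr (n / 2) *
      (indicator {t - 1..<t} \<tau> * (t - \<tau>) powr (n / 2) + indicator {..t - 1} \<tau> * (t - \<tau>) powr (- 1 - s)))"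
    proof (rule AE_I2)
      fix \<tau>
      have split: "(pi * (4 * (t - \<tau>))) powr (n / 2) = (4 * pi) powr (n / 2) * (t - \<tau>) powr (n / 2)"
        by (subst powr_mult[symmetric]) (simp only: mult_ac)
      consider "\<tau> \<ge> t" | "t - 1 < \<tau>" "\<tau> < t" | "\<tau> \<le> t - 1" by linarith
      then show "norm (LINT y|lborel. norm (?L (y, \<tau>))) \<le> norm ((4 * pi) powr (n / 2) *
        (indicator {t - 1..<t} \<tau> * (t - \<tau>) powr (n / 2) + indicator {..t - 1} \<tau> * (t - \<tau>) powr (- 1 - s)))"
      proof cases
        case 2
        have "(pi * (4 * (t - \<tau>))) powr (n / 2) / (1 + (t - \<tau>) powr m) \<le> (pi * (4 * (t - \<tau>))) powr (n / 2) / 1"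
          by (intro divide_left_mono) (auto intro: add_pos_nonneg)
        also have "\<dots> = (4 * pi) powr (n / 2) * (t - \<tau>) powr (n / 2)" using 2 by (simp only: split div_by_1)
        finally show ?thesis unfolding inner using 2 by (simp add: indicator_def abs_mult)
      next
        case 3
        have "(pi * (4 * (t - \<tau>))) powr (n / 2) / (1 + (t - \<tau>) powr m) \<le> (pi * (4 * (t - \<tau>))) powr (n / 2) / (t - \<tau>) powr m"
          using 3 by (intro divide_left_mono mult_pos_pos add_pos_nonneg) auto
        also have "\<dots> = (4 * pi) powr (n / 2) * ((t - \<tau>) powr (n / 2) / (t - \<tau>) powr m)"
          using 3 by (simp only: split times_divide_eq_right)
        also have "(t - \<tau>) powr (n / 2) / (t - \<tau>) powr m = (t - \<tau>) powr (- 1 - s)"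
          by (simp add: m_def flip: powr_diff)
        also have "(4 * pi) powr (n / 2) * (t - \<tau>) powr (- 1 - s) \<le> (4 * pi) powr (n / 2) *
           (indicator {t - 1..<t} \<tau> * (t - \<tau>) powr (n / 2) + indicator {..t - 1} \<tau> * (t - \<tau>) powr (- 1 - s))"
          using 3 by (intro mult_left_mono) auto
        finally show ?thesis unfolding inner using 3 by (simp add: indicator_def abs_mult)
      qed (auto simp: inner)
    qed
  qed measurable
  have "integrable (lborel \<Otimes>\<^sub>M lborel) (\<lambda>(\<tau>, y). ?L (y, \<tau>))"
  proof (rule lborel_pair.Fubini_integrable)
    show "integrable lborel (\<lambda>x. LBINT y. norm (case (x, y) of (\<tau>, y) \<Rightarrow> ?L (y, \<tau>)))" using outer by simp
    show "AE x in lborel. integrable lborel (\<lambda>y. case (x, y) of (\<tau>, y) \<Rightarrow> ?L (y, \<tau>))" using inner by simp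
    show "(\<lambda>(\<tau>, y). ?L (y, \<tau>)) \<in> borel_measurable (lborel \<Otimes>\<^sub>M lborel)" by measurable
  qed
  then have "integrable (lborel \<Otimes>\<^sub>M lborel) (\<lambda>(y, \<tau>). ?L (y, \<tau>))"
    using lborel_pair.integrable_product_swap_iff[of "\<lambda>(\<tau>, y). ?L (y, \<tau>)"] by (simp add: case_prod_beta)
  then show ?thesis by (simp add: lborel_prod case_prod_beta')
qed

text \<open>For h \<ge> 1/2 the factor h^(-m) is harmless and the Gaussian is recentred from width h
  to h + 1. For small h the Gaussian is split into two equal factors of double width: one is
  recentred, the other, being at distance at least \<rho>, absorbs h^(-m).\<close>

lemma frac_kernel_far_bound:
  fixes x :: "real^'n::finite"
  assumes m: "m > 0" and \<rho>: "\<rho> > 0"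
  shows "\<exists>C\<ge>0. \<forall>y h. h > 0 \<longrightarrow> (\<rho> \<le> dist y x \<or> h \<ge> 1/2) \<longrightarrow>
     exp (- (norm (x - y))\<^sup>2 / (4 * h)) / h powr m \<le> C * (exp (- (norm y)\<^sup>2 / (4 * (h + 1))) / (1 + (h + 1) powr m))"
proof -
  define E where "E = exp ((norm x)\<^sup>2 / 2)"
  \<comment> \<open>\<open>C1\<close> comes from 1 \<le> 2h and h + 1 \<le> 3h when h \<ge> 1/2.
    \<open>C2\<close> comes from \<open>powr_le_exp\<close> at \<rho>^2/(8h), multiplied by the
    bound of 1 + (h+1)^m for h < 1/2.\<close>
  define C1 where "C1 = 2 powr m + 3 powr m"
  define C2 where "C2 = (8 / \<rho>\<^sup>2) powr m * m powr m * (1 + 2 powr m)"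
  have pos: "E > 0" "C1 \<ge> 0" "C2 \<ge> 0" by (auto simp: E_def C1_def C2_def)
  have "exp (- (norm (x - y))\<^sup>2 / (4 * h)) / h powr m
      \<le> (E * (C1 + C2)) * (exp (- (norm y)\<^sup>2 / (4 * (h + 1))) / (1 + (h + 1) powr m))"
    if h: "h > 0" and far: "\<rho> \<le> dist y x \<or> h \<ge> 1/2" for y h
  proof (cases "h \<ge> 1/2")
    case True
    have "exp (- (norm (x - y))\<^sup>2 / (4 * h)) \<le> exp ((norm x)\<^sup>2 / (4 * (h + 1 - h))) * exp (- (norm y)\<^sup>2 / (4 * (h + 1)))"
      by (rule gaussian_recenter) (use h in auto)
    also have "\<dots> \<le> E * exp (- (norm y)\<^sup>2 / (4 * (h + 1)))"
      unfolding E_def by (intro mult_right_mono) auto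
    finally have 1: "exp (- (norm (x - y))\<^sup>2 / (4 * h)) \<le> E * exp (- (norm y)\<^sup>2 / (4 * (h + 1)))" .
    have "1 + (h + 1) powr m \<le> (2 * h) powr m + (3 * h) powr m"
      using True m by (intro add_mono ge_one_powr_ge_zero powr_mono2) auto
    also have "\<dots> = C1 * h powr m" using h by (simp add: C1_def powr_mult algebra_simps)
    also have "\<dots> \<le> (C1 + C2) * h powr m" using pos by (intro mult_right_mono) auto
    finally have "1 / h powr m \<le> (C1 + C2) / (1 + (h + 1) powr m)"
      using h by (simp add: divide_simps add_pos_nonneg)
    with 1 have "exp (- (norm (x - y))\<^sup>2 / (4 * h)) * (1 / h powr m)
        \<le> E * exp (- (norm y)\<^sup>2 / (4 * (h + 1))) * ((C1 + C2) / (1 + (h + 1) powr m))"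
      using pos h by (intro mult_mono) auto
    then show ?thesis by (simp add: mult_ac)
  next
    case False
    with far have d: "\<rho> \<le> norm (x - y)" and h2: "h < 1/2" by (auto simp: dist_norm norm_minus_commute)
    have "exp (- (norm (x - y))\<^sup>2 / (4 * (2 * h))) \<le> exp ((norm x)\<^sup>2 / (4 * (h + 1 - 2 * h))) * exp (- (norm y)\<^sup>2 / (4 * (h + 1)))"
      by (rule gaussian_recenter) (use h h2 in auto)
    also have "\<dots> \<le> E * exp (- (norm y)\<^sup>2 / (4 * (h + 1)))"
    proof -
      have "(norm x)\<^sup>2 / (4 * (h + 1 - 2 * h)) \<le> (norm x)\<^sup>2 / 2"
        using h2 by (intro divide_left_mono) auto
      then show ?thesis unfolding E_def by (intro mult_right_mono) auto
    qed
    finally have 1: "exp (- (norm (x - y))\<^sup>2 / (8 * h)) \<le> E * exp (- (norm y)\<^sup>2 / (4 * (h + 1)))"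
      by (simp add: mult.assoc[symmetric])
    have "(\<rho>\<^sup>2 / (8 * h)) powr m \<le> m powr m * exp (\<rho>\<^sup>2 / (8 * h))"
      using h m by (intro powr_le_exp) auto
    also have "(\<rho>\<^sup>2 / (8 * h)) powr m = (1 / h powr m) / (8 / \<rho>\<^sup>2) powr m"
      using h \<rho> by (simp add: powr_divide powr_mult)
    finally have "exp (- \<rho>\<^sup>2 / (8 * h)) / h powr m \<le> (8 / \<rho>\<^sup>2) powr m * m powr m"
      using h \<rho> by (simp add: exp_minus field_simps)
    moreover have "exp (- (norm (x - y))\<^sup>2 / (8 * h)) / h powr m \<le> exp (- \<rho>\<^sup>2 / (8 * h)) / h powr m"
      using d h \<rho> by (intro divide_right_mono) (auto intro!: divide_right_mono power_mono)
    ultimately have 2: "exp (- (norm (x - y))\<^sup>2 / (8 * h)) / h powr m \<le> (8 / \<rho>\<^sup>2) powr m * m powr m" by linarith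
    have 3: "1 + (h + 1) powr m \<le> 1 + 2 powr m" using h h2 m by (intro add_left_mono powr_mono2) auto
    have "(8 / \<rho>\<^sup>2) powr m * m powr m = C2 / (1 + 2 powr m)"
      unfolding C2_def by (smt (verit) nonzero_mult_div_cancel_right powr_ge_zero)
    also have "\<dots> \<le> (C1 + C2) / (1 + (h + 1) powr m)"
      using 3 pos by (intro frac_le) (auto intro: add_pos_nonneg)
    finally have 4: "exp (- (norm (x - y))\<^sup>2 / (8 * h)) / h powr m \<le> (C1 + C2) / (1 + (h + 1) powr m)" using 2 by linarith
    have "exp (- (norm (x - y))\<^sup>2 / (4 * h)) / h powr m
       = exp (- (norm (x - y))\<^sup>2 / (8 * h)) * (exp (- (norm (x - y))\<^sup>2 / (8 * h)) / h powr m)"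
      by (simp add: field_simps flip: exp_add)
    also have "\<dots> \<le> E * exp (- (norm y)\<^sup>2 / (4 * (h + 1))) * ((C1 + C2) / (1 + (h + 1) powr m))"
      using 1 4 pos by (intro mult_mono) auto
    finally show ?thesis by (simp add: mult_ac)
  qed
  then show ?thesis using pos by (intro exI[of _ "E * (C1 + C2)"]) auto
qed

lemma frac_integrand_measurable:
  fixes u :: "real^'n::finite \<Rightarrow> real \<Rightarrow> real"
  assumes [measurable]: "(\<lambda>p. u (fst p) (snd p)) \<in> borel_measurable borel"
  shows "(\<lambda>p. frac_heat_integrand s u x t (fst p) (snd p)) \<in> borel_measurable borel"
  unfolding frac_heat_integrand_def borel_prod[symmetric]
proof -
  have [measurable]: "(\<lambda>p. u (fst p) (snd p)) \<in> borel_measurable (borel \<Otimes>\<^sub>M borel)"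
    using assms by (simp add: borel_prod)
  show "(\<lambda>p. (u x t - u (fst p) (snd p)) / (t - snd p) powr (real CARD('n) / 2 + 1 + s) *
      exp (- (norm (x - fst p))\<^sup>2 / (4 * (t - snd p)))) \<in> borel_measurable (borel \<Otimes>\<^sub>M borel)"
    by measurable
qed

lemma frac_integrand_far_integrable:
  fixes u :: "real^'n::finite \<Rightarrow> real \<Rightarrow> real" and x :: "real^'n"
  assumes u: "u \<in> space_L s" and s: "0 < s" and \<rho>: "\<rho> > 0"
  shows "integrable lborel (\<lambda>p. indicator {p. snd p < t \<and> (\<rho> \<le> dist (fst p) x \<or> snd p \<le> t - 1/2)} p *
     frac_heat_integrand s u x t (fst p) (snd p))"
proof -
  have um [measurable]: "(\<lambda>p. u (fst p) (snd p)) \<in> borel_measurable borel" using space_L_measurable[OF u] .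
  define m where "m = real CARD('n) / 2 + 1 + s"
  have m: "m > 0" using s by (simp add: m_def add_nonneg_pos)
  \<comment> \<open>The weight is taken at the later time t + 1, where its Gaussian is wider than
    the kernel's; this leaves the room that recentring needs.\<close>
  define L where "L = (\<lambda>p::(real^'n) \<times> real. indicator {p. snd p < t + 1} p *
      (exp (- (norm (fst p))\<^sup>2 / (4 * (t + 1 - snd p))) / (1 + (t + 1 - snd p) powr m)))"
  have L0: "L p \<ge> 0" for p by (auto simp: L_def indicator_def)
  have iL: "integrable lborel L" unfolding L_def m_def by (rule integrable_space_L_kernel[OF s])
  have iuL: "integrable lborel (\<lambda>p. \<bar>u (fst p) (snd p)\<bar> * L p)"
  proof (rule integrableI_bounded)
    show "(\<lambda>p. \<bar>u (fst p) (snd p)\<bar> * L p) \<in> borel_measurable lborel"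
      using iL by (intro borel_measurable_times) (auto intro!: borel_measurable_abs simp: um)
    have "(\<integral>\<^sup>+ p. ennreal (indicator {p::(real^'n) \<times> real. snd p < t + 1} p *
              (\<bar>u (fst p) (snd p)\<bar> * exp (- (norm (fst p))\<^sup>2 / (4 * (t + 1 - snd p)))
               / (1 + (t + 1 - snd p) powr (real CARD('n) / 2 + 1 + s)))) \<partial>lborel) < \<infinity>"
      using u unfolding space_L_def by blast
    then show "(\<integral>\<^sup>+ p. ennreal (norm (\<bar>u (fst p) (snd p)\<bar> * L p)) \<partial>lborel) < \<infinity>"
      using L0 by (simp add: abs_mult) (simp add: L_def m_def mult_ac)
  qed
  obtain C where C: "C \<ge> 0" "\<And>y h. h > 0 \<Longrightarrow> (\<rho> \<le> dist y x \<or> h \<ge> 1/2) \<Longrightarrow>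
     exp (- (norm (x - y))\<^sup>2 / (4 * h)) / h powr m \<le> C * (exp (- (norm y)\<^sup>2 / (4 * (h + 1))) / (1 + (h + 1) powr m))"
    using frac_kernel_far_bound[OF m \<rho>, of x] by blast
  have "integrable lborel (\<lambda>p. C * (\<bar>u x t\<bar> * L p + \<bar>u (fst p) (snd p)\<bar> * L p))" using iL iuL by auto
  then show ?thesis
  proof (rule Bochner_Integration.integrable_bound)
    show "AE p in lborel. norm (indicator {p. snd p < t \<and> (\<rho> \<le> dist (fst p) x \<or> snd p \<le> t - 1/2)} p *
     frac_heat_integrand s u x t (fst p) (snd p)) \<le> norm (C * (\<bar>u x t\<bar> * L p + \<bar>u (fst p) (snd p)\<bar> * L p))"
    proof (rule AE_I2)
      fix p :: "(real^'n) \<times> real"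
      obtain y \<tau> where p: "p = (y, \<tau>)" by force
      show "norm (indicator {p. snd p < t \<and> (\<rho> \<le> dist (fst p) x \<or> snd p \<le> t - 1/2)} p *
         frac_heat_integrand s u x t (fst p) (snd p)) \<le> norm (C * (\<bar>u x t\<bar> * L p + \<bar>u (fst p) (snd p)\<bar> * L p))"
      proof (cases "\<tau> < t \<and> (\<rho> \<le> dist y x \<or> \<tau> \<le> t - 1/2)")
        case True
        then have "exp (- (norm (x - y))\<^sup>2 / (4 * (t - \<tau>))) / (t - \<tau>) powr m \<le> C * L p"
          using C(2)[of "t - \<tau>" y] by (simp add: L_def p indicator_def algebra_simps)
        moreover have "\<bar>u x t - u y \<tau>\<bar> \<le> \<bar>u x t\<bar> + \<bar>u y \<tau>\<bar>" by linarith
        ultimately have "\<bar>u x t - u y \<tau>\<bar> * (exp (- (norm (x - y))\<^sup>2 / (4 * (t - \<tau>))) / (t - \<tau>) powr m)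
            \<le> (\<bar>u x t\<bar> + \<bar>u y \<tau>\<bar>) * (C * L p)"
          by (intro mult_mono) auto
        also have "\<dots> = norm (C * (\<bar>u x t\<bar> * L p + \<bar>u y \<tau>\<bar> * L p))"
          using L0[of p] C(1) by (simp add: algebra_simps)
        finally show ?thesis using True
          by (simp add: p frac_heat_integrand_def abs_mult mult_ac m_def)
      qed (auto simp: p)
    qed
  next
    have [measurable]: "(\<lambda>p. frac_heat_integrand s u x t (fst p) (snd p)) \<in> borel_measurable (borel \<Otimes>\<^sub>M borel)"
      using frac_integrand_measurable[OF um] by (simp add: borel_prod)
    have "(\<lambda>p. indicator {p. snd p < t \<and> (\<rho> \<le> dist (fst p) x \<or> snd p \<le> t - 1/2)} p *
       frac_heat_integrand s u x t (fst p) (snd p)) \<in> borel_measurable (borel \<Otimes>\<^sub>M borel)"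
      by measurable
    then show "(\<lambda>p. indicator {p. snd p < t \<and> (\<rho> \<le> dist (fst p) x \<or> snd p \<le> t - 1/2)} p *
       frac_heat_integrand s u x t (fst p) (snd p)) \<in> borel_measurable lborel"
      by (simp add: borel_prod)
  qed
qed

section \<open>Convergence of the defining integral\<close>

lemma frac_integrand_slice_measurable:
  fixes u :: "real^'n::finite \<Rightarrow> real \<Rightarrow> real"
  assumes "u \<in> space_L s"
  shows "(\<lambda>y. frac_heat_integrand s u x t y \<tau>) \<in> borel_measurable borel"
proof -
  have [measurable]: "(\<lambda>p. frac_heat_integrand s u x t (fst p) (snd p)) \<in> borel_measurable (borel \<Otimes>\<^sub>M borel)"
    using frac_integrand_measurable[OF space_L_measurable[OF assms]] by (simp add: borel_prod)
  have p [measurable]: "(\<lambda>y::real^'n. (y, \<tau>)) \<in> borel \<rightarrow>\<^sub>M (borel \<Otimes>\<^sub>M borel)" by measurable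
  show "(\<lambda>y. frac_heat_integrand s u x t y \<tau>) \<in> borel_measurable borel"
    using measurable_compose[OF p, of "\<lambda>p. frac_heat_integrand s u x t (fst p) (snd p)" borel] by simp
qed

text \<open>At a fixed earlier time the kernel is continuous in \<open>y\<close>; the singularity
  appears only as \<tau> tends to \<open>t\<close>. So near \<open>x\<close> the principal value is
  an ordinary integral.\<close>

lemma frac_integrand_ball_integrable:
  fixes u :: "real^'n::finite \<Rightarrow> real \<Rightarrow> real"
  assumes u: "u \<in> space_L s" and c: "continuous_on (cball x \<rho>) (\<lambda>y. u y \<tau>)" and \<tau>: "\<tau> < t"
  shows "set_integrable lborel (cball x \<rho>) (\<lambda>y. frac_heat_integrand s u x t y \<tau>)"
proof -
  have "continuous_on (cball x \<rho>) (\<lambda>y. frac_heat_integrand s u x t y \<tau>)"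
    unfolding frac_heat_integrand_def using \<tau> by (intro continuous_intros c) auto
  then show ?thesis unfolding set_integrable_def
    by (intro borel_integrable_compact) auto
qed

text \<open>This holds at every earlier time, not just almost every one: where the slice is not integrable,
  neither is its restriction to the complement of a small ball, so both sides are the junk value \<open>0\<close>.
  Measurability in time of the inner integral is thereby never an issue.\<close>
lemma frac_heat_inner_eq:
  fixes u :: "real^'n::finite \<Rightarrow> real \<Rightarrow> real"
  assumes u: "u \<in> space_L s" and \<rho>: "\<rho> > 0" and c: "continuous_on (cball x \<rho>) (\<lambda>y. u y \<tau>)" and \<tau>: "\<tau> < t"
  shows "frac_heat_inner s u x t \<tau> = (LINT y|lborel. frac_heat_integrand s u x t y \<tau>)"
proof -
  define f where "f = (\<lambda>y. frac_heat_integrand s u x t y \<tau>)"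
  have [measurable]: "f \<in> borel_measurable borel"
    unfolding f_def using frac_integrand_slice_measurable[OF u] by auto
  have "((\<lambda>\<delta>. LINT y : {y. dist y x > \<delta>} | lborel. f y) \<longlongrightarrow> (LINT y|lborel. f y)) (at_right 0)"
  proof (cases "integrable lborel f")
    case True
    show ?thesis unfolding tendsto_at_iff_sequentially
    proof (intro allI impI)
      fix X :: "nat \<Rightarrow> real" assume X: "\<forall>i. X i \<in> {0<..} - {0}" "X \<longlonglongrightarrow> 0"
      have "(\<lambda>i. LINT y|lborel. indicator {y. dist y x > X i} y *\<^sub>R f y) \<longlonglongrightarrow> (LINT y|lborel. f y)"
      proof (rule integral_dominated_convergence[where w = "\<lambda>y. \<bar>f y\<bar>"])
        show "AE y in lborel. (\<lambda>i. indicator {y. dist y x > X i} y *\<^sub>R f y) \<longlonglongrightarrow> f y"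
          using AE_lborel_singleton[of x]
        proof eventually_elim
          case (elim y)
          then have "\<forall>\<^sub>F i in sequentially. X i < dist y x" using X(2) by (intro order_tendstoD) auto
          then have "\<forall>\<^sub>F i in sequentially. indicator {y. dist y x > X i} y *\<^sub>R f y = f y"
            by eventually_elim simp
          then show ?case by (rule tendsto_eventually)
        qed
      qed (use True in \<open>auto simp: indicator_def\<close>)
      then show "((\<lambda>\<delta>. LINT y : {y. dist y x > \<delta>} | lborel. f y) \<circ> X) \<longlonglongrightarrow> (LINT y|lborel. f y)"
        by (simp add: comp_def set_lebesgue_integral_def)
    qed
  next
    case False
    have "(LINT y : {y. dist y x > \<delta>} | lborel. f y) = 0" if "\<delta> < \<rho>" for \<delta>
    proof -
      have "\<not> set_integrable lborel {y. dist y x > \<delta>} f"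
      proof
        assume "set_integrable lborel {y. dist y x > \<delta>} f"
        then have "set_integrable lborel ({y. dist y x > \<delta>} \<union> cball x \<rho>) f"
          using frac_integrand_ball_integrable[OF u c \<tau>] unfolding f_def
          by (intro set_integrable_Un) auto
        also have "{y. dist y x > \<delta>} \<union> cball x \<rho> = UNIV" using that by (auto simp: dist_commute)
        finally show False using False by (simp add: set_integrable_def)
      qed
      then show ?thesis unfolding set_integrable_def set_lebesgue_integral_def by (rule not_integrable_integral_eq)
    qed
    then have "\<forall>\<^sub>F \<delta> in at_right 0. (LINT y : {y. dist y x > \<delta>} | lborel. f y) = 0"
      using \<rho> by (auto simp: eventually_at_right)
    then show ?thesis using False by (simp add: not_integrable_integral_eq tendsto_eventually)
  qed
  then show ?thesis unfolding frac_heat_inner_def f_def[symmetric]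
    by (metis f_def tendsto_Lim trivial_limit_at_right_real)
qed

text \<open>In the parabolic variable k = q / sqrt h the claim is (k+1)^(2a) \<le> 16 exp(k^2/8):
  half of the Gaussian exponent absorbs the polynomial growth. The 16 makes room for (k+1)^2 \<le> 2
  + 2k^2 \<le> 16 (1 + k^2/8).\<close>

lemma gaussian_holder_bound:
  fixes q h a :: real
  assumes "q \<ge> 0" "h > 0" "0 < a" "a \<le> 1"
  shows "(q + sqrt h) powr (2 * a) * exp (- q\<^sup>2 / (4 * h)) \<le> 16 * h powr a * exp (- q\<^sup>2 / (8 * h))"
proof -
  define k where "k = q / sqrt h"
  have k: "k \<ge> 0" "q + sqrt h = sqrt h * (k + 1)" "k\<^sup>2 = q\<^sup>2 / h"
    using assms by (auto simp: k_def field_simps power_divide)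
  have "(k + 1) powr (2 * a) \<le> (k + 1) powr 2" using k assms by (intro powr_mono) auto
  also have "\<dots> = (k + 1)\<^sup>2" using k by simp
  also have "\<dots> \<le> 16 * (1 + k\<^sup>2 / 8)"
    using sum_squares_ge_zero[of "k - 1" 0] by (simp add: power2_eq_square algebra_simps)
  also have "\<dots> \<le> 16 * exp (k\<^sup>2 / 8)" using exp_ge_add_one_self[of "k\<^sup>2 / 8"] by (intro mult_left_mono) auto
  finally have 1: "(k + 1) powr (2 * a) \<le> 16 * exp (q\<^sup>2 / (8 * h))" by (simp add: k mult.commute)
  have "sqrt h powr (2 * a) = h powr a" using assms by (simp add: powr_half_sqrt[symmetric] powr_powr)
  then have "(q + sqrt h) powr (2 * a) = h powr a * (k + 1) powr (2 * a)" using k by (simp add: powr_mult)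
  then have "(q + sqrt h) powr (2 * a) * exp (- q\<^sup>2 / (4 * h))
     \<le> h powr a * (16 * exp (q\<^sup>2 / (8 * h))) * exp (- q\<^sup>2 / (4 * h))"
    using 1 by (simp add: mult_left_mono mult_right_mono)
  also have "\<dots> = 16 * h powr a * exp (- q\<^sup>2 / (8 * h))"
    using assms by (simp add: field_simps flip: exp_add)
  finally show ?thesis .
qed

text \<open>Symmetrization happens inside the absolute value, so the first-order part of
  \<open>u\<close> cancels. With h = t - \<tau>, the second difference contributes h^a, the Gaussian
  integral h^(n/2) and the kernel h^(-n/2-1-s). The 8 is half of the 16 in
  \<open>gaussian_holder_bound\<close>.\<close>

lemma frac_integrand_near_bound:
  fixes u :: "real^'n::finite \<Rightarrow> real \<Rightarrow> real"
  assumes u: "u \<in> space_L s" and c: "continuous_on (cball x \<rho>) (\<lambda>y. u y \<tau>)" and \<tau>: "\<tau> < t"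
    and a: "0 < a" "a \<le> 1" and C: "C \<ge> 0"
    and sd: "\<And>z. norm z \<le> \<rho> \<Longrightarrow> \<bar>2 * u x t - u (x + z) \<tau> - u (x - z) \<tau>\<bar> \<le> C * (norm z + sqrt (t - \<tau>)) powr (2 * a)"
  shows "\<bar>LINT y|lborel. indicator (cball x \<rho>) y * frac_heat_integrand s u x t y \<tau>\<bar>
     \<le> 8 * C * (8 * pi) powr (real CARD('n) / 2) * (t - \<tau>) powr (a - 1 - s)"
proof -
  define h where "h = t - \<tau>"
  have h: "h > 0" using \<tau> by (simp add: h_def)
  define n where "n = real CARD('n)"
  define g where "g = (\<lambda>y. indicator (cball x \<rho>) y * frac_heat_integrand s u x t y \<tau>)"
  have g: "integrable lborel g"
    using frac_integrand_ball_integrable[OF u c \<tau>] unfolding g_def set_integrable_def by simp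
  define G where "G = (\<lambda>z::real^'n. 8 * C * h powr (a - (n / 2 + 1 + s)) * exp (- (norm (0 - z))\<^sup>2 / (8 * h)))"
  have G: "integrable lborel G" "(LINT z|lborel. G z) = 8 * C * h powr (a - (n / 2 + 1 + s)) * (pi * (8 * h)) powr (n / 2)"
    unfolding G_def using h gaussian_integral_at[of "8 * h" "0::real^'n"] by (auto simp: n_def)
  have le: "\<bar>(g (x + z) + g (x - z)) / 2\<bar> \<le> G z" for z
  proof (cases "norm z \<le> \<rho>")
    case True
    have e: "exp (- (norm z)\<^sup>2 / (4 * h)) \<ge> 0" by simp
    have "\<bar>g (x + z) + g (x - z)\<bar> = \<bar>2 * u x t - u (x + z) \<tau> - u (x - z) \<tau>\<bar> * exp (- (norm z)\<^sup>2 / (4 * h)) / h powr (n / 2 + 1 + s)"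
      using True by (simp add: g_def frac_heat_integrand_def dist_norm h_def n_def abs_mult
         add_divide_distrib[symmetric] distrib_right[symmetric] diff_diff_eq add_diff_eq)
    also have "\<dots> \<le> C * (norm z + sqrt h) powr (2 * a) * exp (- (norm z)\<^sup>2 / (4 * h)) / h powr (n / 2 + 1 + s)"
      using sd[OF True] by (intro divide_right_mono mult_right_mono) (auto simp: h_def)
    also have "\<dots> \<le> C * (16 * h powr a * exp (- (norm z)\<^sup>2 / (8 * h))) / h powr (n / 2 + 1 + s)"
      using gaussian_holder_bound[of "norm z" h a] h a C unfolding mult.assoc
      by (intro divide_right_mono mult_left_mono) auto
    also have "\<dots> = 2 * G z" by (simp add: G_def powr_diff)
    finally show ?thesis by simp
  next
    case False
    then show ?thesis using C by (simp add: g_def dist_norm G_def)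
  qed
  have "\<bar>LINT y|lborel. g y\<bar> = \<bar>LINT z|lborel. (g (x + z) + g (x - z)) / 2\<bar>"
    using integral_symmetrize_point(2)[OF g, of x] by simp
  also have "\<dots> \<le> (LINT z|lborel. \<bar>(g (x + z) + g (x - z)) / 2\<bar>)" by (rule integral_abs_bound)
  also have "\<dots> \<le> (LINT z|lborel. G z)"
    using integral_symmetrize_point(1)[OF g, of x] le
    by (intro integral_mono G(1) integrable_abs integrable_divide) auto
  also have "\<dots> = 8 * C * (h powr (a - (n / 2 + 1 + s)) * (8 * pi * h) powr (n / 2))" by (simp add: G mult_ac)
  also have "\<dots> = 8 * C * ((8 * pi) powr (n / 2) * h powr (a - 1 - s))"
    using h by (simp add: powr_mult powr_add[symmetric] mult.left_commute[of "h powr _"] add_diff_eq)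
  finally show ?thesis by (simp add: g_def h_def n_def mult_ac)
qed

text \<open>Fubini is applied only on the far region \<open>R\<close>. Near (x, t) the cancellation
  in \<open>y\<close> has to take place at each time before absolute values are taken, so that part
  is estimated slice by slice.\<close>

lemma frac_heat_slices_integrable:
  fixes u :: "real^'n::finite \<Rightarrow> real \<Rightarrow> real"
  assumes u: "u \<in> space_L s" and s: "0 < s" and \<rho>: "\<rho> > 0"
    and c: "\<And>\<tau>. continuous_on (cball x \<rho>) (\<lambda>y. u y \<tau>)"
    and a: "s < a" "a \<le> 1" and C: "C \<ge> 0"
    and sd: "\<And>z h. norm z \<le> \<rho> \<Longrightarrow> 0 \<le> h \<Longrightarrow> h \<le> 1 \<Longrightarrow>
       \<bar>2 * u x t - u (x + z) (t - h) - u (x - z) (t - h)\<bar> \<le> C * (norm z + sqrt h) powr (2 * a)"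
  shows "set_integrable lborel {..<t} (\<lambda>\<tau>. LINT y|lborel. frac_heat_integrand s u x t y \<tau>)"
    and "AE \<tau> in lborel. \<tau> < t \<longrightarrow> integrable lborel (\<lambda>y. frac_heat_integrand s u x t y \<tau>)"
proof -
  define F where "F = frac_heat_integrand s u x t"
  define R where "R = {p::(real^'n) \<times> real. snd p < t \<and> (\<rho> \<le> dist (fst p) x \<or> snd p \<le> t - 1/2)}"
  have "integrable (lborel \<Otimes>\<^sub>M lborel) (\<lambda>(y, \<tau>). indicator R (y, \<tau>) * F y \<tau>)"
    using frac_integrand_far_integrable[OF u s \<rho>, of t x] unfolding F_def R_def
    by (simp add: lborel_prod case_prod_beta')
  then have far_ae: "AE \<tau> in lborel. integrable lborel (\<lambda>y. indicator R (y, \<tau>) * F y \<tau>)"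
    and far_int: "integrable lborel (\<lambda>\<tau>. LINT y|lborel. indicator R (y, \<tau>) * F y \<tau>)"
    using lborel_pair.AE_integrable_snd lborel_pair.integrable_snd by blast+
  have near: "integrable lborel (\<lambda>y. indicator (cball x \<rho>) y * F y \<tau>)" if "\<tau> < t" for \<tau>
    using frac_integrand_ball_integrable[OF u c that] unfolding F_def set_integrable_def by simp
  \<comment> \<open>The closed ball and \<open>R\<close> overlap on the sphere, where the
    decomposition would count the integrand twice.\<close>
  have sph: "AE y in lborel. y \<notin> sphere x \<rho>"
    using negligible_sphere[of x \<rho>] by (intro AE_not_in) (simp add: negligible_iff_null_sets null_sets_completion_iff)
  have [measurable]: "(\<lambda>p. F (fst p) (snd p)) \<in> borel_measurable (borel \<Otimes>\<^sub>M borel)"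
    using frac_integrand_measurable[OF space_L_measurable[OF u]] unfolding F_def by (simp add: borel_prod)
  have swap [measurable]: "(\<lambda>p. F (snd p) (fst p)) \<in> borel_measurable (borel \<Otimes>\<^sub>M borel)"
  proof -
    have p [measurable]: "(\<lambda>p::real \<times> (real^'n). (snd p, fst p)) \<in> (borel \<Otimes>\<^sub>M borel) \<rightarrow>\<^sub>M (borel \<Otimes>\<^sub>M borel)" by measurable
    show ?thesis using measurable_compose[OF p, of "\<lambda>p. F (fst p) (snd p)" borel] by simp
  qed
  have Fm [measurable]: "(\<lambda>y. F y \<tau>) \<in> borel_measurable borel" for \<tau>
    unfolding F_def by (rule frac_integrand_slice_measurable[OF u])
  have decomp: "AE y in lborel. F y \<tau> = indicator R (y, \<tau>) * F y \<tau> +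
       (if t - 1/2 < \<tau> then indicator (cball x \<rho>) y * F y \<tau> else 0)" if "\<tau> < t" for \<tau>
    using sph by eventually_elim (use that in \<open>auto simp: R_def indicator_def dist_commute\<close>)
  have ae: "AE \<tau> in lborel. \<tau> < t \<longrightarrow> integrable lborel (\<lambda>y. F y \<tau>) \<and>
      \<bar>LINT y|lborel. F y \<tau>\<bar> \<le> \<bar>LINT y|lborel. indicator R (y, \<tau>) * F y \<tau>\<bar> +
        indicator {t - 1/2..<t} \<tau> * (8 * C * (8 * pi) powr (real CARD('n) / 2) * (t - \<tau>) powr (a - 1 - s))"
    using far_ae
  proof eventually_elim
    case (elim \<tau>)
    show ?case
    proof
      assume \<tau>: "\<tau> < t"
      define N where "N = (\<lambda>y. if t - 1/2 < \<tau> then indicator (cball x \<rho>) y * F y \<tau> else 0)"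
      have N: "integrable lborel N" using near[OF \<tau>] by (cases "t - 1/2 < \<tau>") (simp_all add: N_def)
      have N': "\<bar>LINT y|lborel. N y\<bar> \<le> indicator {t - 1/2..<t} \<tau> * (8 * C * (8 * pi) powr (real CARD('n) / 2) * (t - \<tau>) powr (a - 1 - s))"
      proof (cases "t - 1/2 < \<tau>")
        case True
        have "\<bar>LINT y|lborel. indicator (cball x \<rho>) y * F y \<tau>\<bar> \<le> 8 * C * (8 * pi) powr (real CARD('n) / 2) * (t - \<tau>) powr (a - 1 - s)"
          unfolding F_def using sd[of _ "t - \<tau>"] \<tau> True a s C
          by (intro frac_integrand_near_bound[OF u c \<tau>]) auto
        then show ?thesis using True \<tau> by (simp add: N_def)
      next
        case False
        then show ?thesis using C by (simp add: N_def)
      qed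
      have i: "integrable lborel (\<lambda>y. indicator R (y, \<tau>) * F y \<tau> + N y)" using elim N by auto
      have ae: "AE y in lborel. F y \<tau> = indicator R (y, \<tau>) * F y \<tau> + N y" using decomp[OF \<tau>] by (simp add: N_def)
      have 1: "integrable lborel (\<lambda>y. F y \<tau>)"
        by (rule Bochner_Integration.integrable_cong_AE_imp[OF i]) (use ae in \<open>auto simp: eq_commute\<close>)
      have "(LINT y|lborel. F y \<tau>) = (LINT y|lborel. indicator R (y, \<tau>) * F y \<tau> + N y)"
        by (rule integral_cong_AE) (use ae i in auto)
      also have "\<dots> = (LINT y|lborel. indicator R (y, \<tau>) * F y \<tau>) + (LINT y|lborel. N y)"
        using elim N by (rule Bochner_Integration.integral_add)
      finally show "integrable lborel (\<lambda>y. F y \<tau>) \<and>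
        \<bar>LINT y|lborel. F y \<tau>\<bar> \<le> \<bar>LINT y|lborel. indicator R (y, \<tau>) * F y \<tau>\<bar> +
        indicator {t - 1/2..<t} \<tau> * (8 * C * (8 * pi) powr (real CARD('n) / 2) * (t - \<tau>) powr (a - 1 - s))"
        using 1 N' by linarith
    qed
  qed
  then show "AE \<tau> in lborel. \<tau> < t \<longrightarrow> integrable lborel (\<lambda>y. frac_heat_integrand s u x t y \<tau>)"
    unfolding F_def by auto
  have "integrable lborel (\<lambda>\<tau>. \<bar>LINT y|lborel. indicator R (y, \<tau>) * F y \<tau>\<bar> +
      8 * C * (8 * pi) powr (real CARD('n) / 2) * (indicator {t - 1/2..<t} \<tau> * (t - \<tau>) powr (a - 1 - s)))"
    using far_int has_bochner_integral_powr_near[of "a - 1 - s" "1/2" t] a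
    by (intro Bochner_Integration.integrable_add integrable_mult_right integrable_abs)
      (auto simp: has_bochner_integral_iff)
  then show "set_integrable lborel {..<t} (\<lambda>\<tau>. LINT y|lborel. frac_heat_integrand s u x t y \<tau>)"
    unfolding set_integrable_def F_def[symmetric]
  proof (rule Bochner_Integration.integrable_bound)
    show "AE \<tau> in lborel. norm (indicator {..<t} \<tau> *\<^sub>R (LINT y|lborel. F y \<tau>)) \<le>
      norm (\<bar>LINT y|lborel. indicator R (y, \<tau>) * F y \<tau>\<bar> +
      8 * C * (8 * pi) powr (real CARD('n) / 2) * (indicator {t - 1/2..<t} \<tau> * (t - \<tau>) powr (a - 1 - s)))"
      using ae
    proof eventually_elim
      case (elim \<tau>)
      then show ?case by (cases "\<tau> < t") (auto simp: mult_ac)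
    qed
    show "(\<lambda>\<tau>. indicator {..<t} \<tau> *\<^sub>R (LINT y|lborel. F y \<tau>)) \<in> borel_measurable lborel"
      by measurable
  qed
qed

section \<open>Bump perturbation and folding along the hyperplane\<close>

text \<open>The sign of the last term makes the kernel smaller at the mirror image when both points
  lie in the half space; its size limits by how much.\<close>

lemma norm_diff_refl_lam:
  fixes x y :: "real^'n::{finite,wellorder}"
  shows "(norm (x - refl_lam lam y))\<^sup>2 = (norm (x - y))\<^sup>2 + 4 * (lam - x1 x) * (lam - x1 y)"
proof -
  have sq: "(norm z)\<^sup>2 = (z $ fst_idx)\<^sup>2 + (\<Sum>i\<in>UNIV - {fst_idx}. (z $ i)\<^sup>2)" for z :: "real^'n::{finite,wellorder}"
    unfolding power2_norm_eq_inner inner_vec_def by (simp add: power2_eq_square sum.remove[of UNIV fst_idx])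
  have "(\<Sum>i\<in>UNIV - {fst_idx}. ((x - refl_lam lam y) $ i)\<^sup>2) = (\<Sum>i\<in>UNIV - {fst_idx}. ((x - y) $ i)\<^sup>2)"
    by (intro sum.cong) (auto simp: refl_lam_def)
  then show ?thesis unfolding sq by (simp add: refl_lam_def x1_def power2_eq_square algebra_simps)
qed

lemma refl_lam_refl_lam [simp]: "refl_lam lam (refl_lam lam y) = y"
  by (simp add: refl_lam_def vec_eq_iff)

lemma x1_refl_lam: "x1 (refl_lam lam y) = 2 * lam - x1 y"
  by (simp add: x1_def refl_lam_def)

lemma x1_diff_le_norm: "\<bar>x1 x - x1 y\<bar> \<le> norm (x - y)"
  using component_le_norm_cart[of "x - y" fst_idx] by (simp add: x1_def)

lemma AE_not_in_T_lam: "AE y in lborel. x1 (y :: real^'n::{finite,wellorder}) \<noteq> lam"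
proof -
  have "negligible {y :: real^'n::{finite,wellorder}. axis fst_idx 1 \<bullet> y = lam}"
    by (intro negligible_hyperplane) (simp add: axis_eq_0_iff)
  then have n: "negligible {y :: real^'n::{finite,wellorder}. x1 y = lam}" by (simp add: x1_def inner_axis')
  have "closed {y :: real^'n::{finite,wellorder}. x1 y = lam}"
    unfolding x1_def by (intro closed_Collect_eq continuous_intros)
  then have "{y :: real^'n::{finite,wellorder}. x1 y = lam} \<in> null_sets lborel"
    using n by (simp add: negligible_iff_null_sets null_sets_completion_iff borel_closed)
  from AE_not_in[OF this] show ?thesis by simp
qed

text \<open>A truncated paraboloid instead of a smooth cutoff: second differences are needed only
  from one side and only where the bump is positive, and there truncation at 0 can only raise the
  two other values.\<close>

definition bump :: "real^'n::finite \<Rightarrow> real \<Rightarrow> real \<Rightarrow> real^'n \<Rightarrow> real \<Rightarrow> real" where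
  "bump x0 t0 r y \<tau> = max 0 (1 - (norm (y - x0))\<^sup>2 / r\<^sup>2 - (\<tau> - t0)\<^sup>2 / r ^ 4)"

lemma bump_bounds: "0 \<le> bump x0 t0 r y \<tau>" "bump x0 t0 r y \<tau> \<le> 1"
proof -
  show "0 \<le> bump x0 t0 r y \<tau>" by (simp add: bump_def)
  have "0 \<le> (norm (y - x0))\<^sup>2 / r\<^sup>2" "0 \<le> (\<tau> - t0)\<^sup>2 / r ^ 4" by auto
  then have "1 - (norm (y - x0))\<^sup>2 / r\<^sup>2 - (\<tau> - t0)\<^sup>2 / r ^ 4 \<le> 1" by linarith
  then show "bump x0 t0 r y \<tau> \<le> 1" unfolding bump_def by (intro max.boundedI) simp_all
qed

lemma bump_pos_imp:
  assumes "bump x0 t0 r y \<tau> > 0" "r > 0"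
  shows "norm (y - x0) < r" "\<bar>\<tau> - t0\<bar> < r\<^sup>2"
proof -
  have nn: "0 \<le> (norm (y - x0))\<^sup>2 / r\<^sup>2" "0 \<le> (\<tau> - t0)\<^sup>2 / r ^ 4" by auto
  have p: "(norm (y - x0))\<^sup>2 / r\<^sup>2 + (\<tau> - t0)\<^sup>2 / r ^ 4 < 1" using assms by (simp add: bump_def)
  then have "(norm (y - x0))\<^sup>2 / r\<^sup>2 < 1" using nn by linarith
  then have "(norm (y - x0))\<^sup>2 < r\<^sup>2" using assms by (simp add: divide_simps)
  then show "norm (y - x0) < r" using assms by (simp add: power2_less_imp_less)
  have "(\<tau> - t0)\<^sup>2 / r ^ 4 < 1" using p nn by linarith
  then have "(\<tau> - t0)\<^sup>2 < (r\<^sup>2)\<^sup>2" using assms by (simp add: divide_simps flip: power_mult)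
  then have "\<bar>\<tau> - t0\<bar>\<^sup>2 < (r\<^sup>2)\<^sup>2" by simp
  then show "\<bar>\<tau> - t0\<bar> < r\<^sup>2" by (rule power2_less_imp_less) simp
qed

lemma bump_center: "bump x0 t0 r x0 t0 = 1" by (simp add: bump_def)

lemma continuous_bump: "continuous_on S (\<lambda>p. bump x0 t0 r (fst p) (snd p))"
  unfolding bump_def divide_inverse by (intro continuous_intros)

lemma bump_second_difference:
  fixes x z :: "real^'n::finite"
  assumes pos: "bump x0 t0 r x t > 0" and r: "r > 0" and h: "0 < h" "h \<le> r\<^sup>2"
  shows "2 * bump x0 t0 r x t - bump x0 t0 r (x + z) (t - h) - bump x0 t0 r (x - z) (t - h)
    \<le> 6 / r\<^sup>2 * (norm z + sqrt h) powr 2"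
proof -
  define P where "P y \<tau> = 1 - (norm (y - x0))\<^sup>2 / r\<^sup>2 - (\<tau> - t0)\<^sup>2 / r ^ 4" for y :: "real^'n" and \<tau>
  have b: "bump x0 t0 r x t = P x t" "bump x0 t0 r y \<tau> \<ge> P y \<tau>" for y \<tau>
    using pos by (auto simp: bump_def P_def)
  have par: "(norm (x + z - x0))\<^sup>2 + (norm (x - z - x0))\<^sup>2 = 2 * (norm (x - x0))\<^sup>2 + 2 * (norm z)\<^sup>2"
  proof -
    have "x + z - x0 = (x - x0) + z" "x - z - x0 = (x - x0) - z" by auto
    then show ?thesis by (simp add: power2_norm_eq_inner inner_add inner_diff algebra_simps inner_commute)
  qed
  \<comment> \<open>Positivity of the bump gives |t - t0| < r^2, and h \<le> r^2; hence the factor 3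
    r^2 below.\<close>
  have "(t - h - t0)\<^sup>2 - (t - t0)\<^sup>2 = h * (h - 2 * (t - t0))" by (simp add: power2_eq_square algebra_simps)
  also have "\<dots> \<le> h * (3 * r\<^sup>2)" using h bump_pos_imp[OF pos r] by (intro mult_left_mono) auto
  finally have "((t - h - t0)\<^sup>2 - (t - t0)\<^sup>2) / r ^ 4 \<le> h * (3 * r\<^sup>2) / r ^ 4" using r by (intro divide_right_mono) auto
  also have "\<dots> = 3 * h / r\<^sup>2" using r by (simp add: field_simps eval_nat_numeral)
  finally have T: "(t - h - t0)\<^sup>2 / r ^ 4 - (t - t0)\<^sup>2 / r ^ 4 \<le> 3 * h / r\<^sup>2" by (simp add: diff_divide_distrib)
  have "2 * bump x0 t0 r x t - bump x0 t0 r (x + z) (t - h) - bump x0 t0 r (x - z) (t - h)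
     \<le> 2 * P x t - P (x + z) (t - h) - P (x - z) (t - h)"
    using b(1) b(2)[of "x + z" "t - h"] b(2)[of "x - z" "t - h"] by linarith
  also have "\<dots> = ((norm (x + z - x0))\<^sup>2 + (norm (x - z - x0))\<^sup>2 - 2 * (norm (x - x0))\<^sup>2) / r\<^sup>2
      + 2 * ((t - h - t0)\<^sup>2 / r ^ 4 - (t - t0)\<^sup>2 / r ^ 4)"
    by (simp add: P_def add_divide_distrib diff_divide_distrib)
  also have "\<dots> \<le> 2 * (norm z)\<^sup>2 / r\<^sup>2 + 2 * (3 * h / r\<^sup>2)" using T by (simp add: par)
  also have "\<dots> = (2 * (norm z)\<^sup>2 + 6 * h) / r\<^sup>2" by (simp add: add_divide_distrib)
  also have "\<dots> \<le> 6 * (norm z + sqrt h)\<^sup>2 / r\<^sup>2"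
    using r h by (intro divide_right_mono) (auto simp: power2_sum)
  also have "(norm z + sqrt h)\<^sup>2 = (norm z + sqrt h) powr 2" using h by simp
  finally show ?thesis by simp
qed

lemma bump_measurable [measurable]: "(\<lambda>y. bump x0 t0 r y \<tau>) \<in> borel_measurable borel"
  unfolding bump_def by measurable

lemma bump_slice_integrable:
  fixes x :: "real^'n::finite"
  assumes h: "h > 0"
  shows "integrable lborel (\<lambda>y. (c - bump x0 t0 r y \<tau>) * exp (- (norm (x - y))\<^sup>2 / (4 * h)))"
proof (rule Bochner_Integration.integrable_bound)
  show "integrable lborel (\<lambda>y. (\<bar>c\<bar> + 1) * exp (- (norm (x - y))\<^sup>2 / (4 * h)))"
    using h by (intro integrable_mult_right gaussian_integral_at) auto
  have "\<bar>c - bump x0 t0 r y \<tau>\<bar> \<le> \<bar>c\<bar> + 1" for y using bump_bounds[of x0 t0 r y \<tau>] by linarith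
  then show "AE y in lborel. norm ((c - bump x0 t0 r y \<tau>) * exp (- (norm (x - y))\<^sup>2 / (4 * h)))
      \<le> norm ((\<bar>c\<bar> + 1) * exp (- (norm (x - y))\<^sup>2 / (4 * h)))"
    by (intro AE_I2) (simp add: abs_mult mult_right_mono)
qed measurable

text \<open>Up to the parabolic time r^2 the second difference bound combines with
  \<open>gaussian_holder_bound\<close> at exponent 1, and 48 = 6 * 16 / 2. Beyond it the trivial
  bound by 1 is good enough.\<close>

lemma bump_slice_upper_bound:
  fixes x :: "real^'n::finite"
  assumes pos: "bump x0 t0 r x t > 0" and r: "r > 0" and h: "0 < h"
  shows "(LINT y|lborel. (bump x0 t0 r x t - bump x0 t0 r y (t - h)) * exp (- (norm (x - y))\<^sup>2 / (4 * h)))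
    \<le> (if h < r\<^sup>2 then 48 * h / r\<^sup>2 * (8 * pi * h) powr (real CARD('n) / 2) else (4 * pi * h) powr (real CARD('n) / 2))"
proof -
  define g where "g = (\<lambda>y. (bump x0 t0 r x t - bump x0 t0 r y (t - h)) * exp (- (norm (x - y))\<^sup>2 / (4 * h)))"
  have g: "integrable lborel g" unfolding g_def by (rule bump_slice_integrable[OF h])
  show ?thesis
  proof (cases "h < r\<^sup>2")
    case True
    have "(LINT y|lborel. g y) = (LINT z|lborel. (g (x + z) + g (x - z)) / 2)"
      by (rule integral_symmetrize_point(2)[OF g])
    also have "\<dots> \<le> (LINT z|lborel. 48 * h / r\<^sup>2 * exp (- (norm ((0::real^'n) - z))\<^sup>2 / (8 * h)))"
    proof (rule integral_mono)
      show "integrable lborel (\<lambda>z. (g (x + z) + g (x - z)) / 2)"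
        using integral_symmetrize_point(1)[OF g] by auto
      show "integrable lborel (\<lambda>z::real^'n. 48 * h / r\<^sup>2 * exp (- (norm (0 - z))\<^sup>2 / (8 * h)))"
        using h by (intro integrable_mult_right gaussian_integral_at) auto
      fix z :: "real^'n"
      have "g (x + z) + g (x - z) = (2 * bump x0 t0 r x t - bump x0 t0 r (x + z) (t - h) - bump x0 t0 r (x - z) (t - h))
          * exp (- (norm z)\<^sup>2 / (4 * h))"
        by (simp add: g_def algebra_simps)
      also have "\<dots> \<le> (6 / r\<^sup>2 * (norm z + sqrt h) powr 2) * exp (- (norm z)\<^sup>2 / (4 * h))"
        using True by (intro mult_right_mono bump_second_difference pos r h) auto
      also have "\<dots> \<le> 6 / r\<^sup>2 * (16 * h powr 1 * exp (- (norm z)\<^sup>2 / (8 * h)))"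
        using gaussian_holder_bound[of "norm z" h 1] h unfolding mult.assoc by (intro mult_left_mono) auto
      finally show "(g (x + z) + g (x - z)) / 2 \<le> 48 * h / r\<^sup>2 * exp (- (norm (0 - z))\<^sup>2 / (8 * h))"
        using h by simp
    qed
    also have "\<dots> = 48 * h / r\<^sup>2 * (pi * (8 * h)) powr (real CARD('n) / 2)"
      using gaussian_integral_at(2)[of "8 * h" "0::real^'n"] h by simp
    finally show ?thesis using True by (simp add: g_def mult_ac)
  next
    case False
    have "(LINT y|lborel. g y) \<le> (LINT y|lborel. exp (- (norm (x - y))\<^sup>2 / (4 * h)))"
    proof (rule integral_mono[OF g])
      show "integrable lborel (\<lambda>y. exp (- (norm (x - y))\<^sup>2 / (4 * h)))"
        using h by (intro gaussian_integral_at) auto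
      fix y
      have "bump x0 t0 r x t - bump x0 t0 r y (t - h) \<le> 1"
        using bump_bounds[of x0 t0 r y "t - h"] bump_bounds[of x0 t0 r x t] by linarith
      then show "g y \<le> exp (- (norm (x - y))\<^sup>2 / (4 * h))" unfolding g_def by (simp add: mult_left_le_one_le)
    qed
    also have "\<dots> = (pi * (4 * h)) powr (real CARD('n) / 2)"
      using gaussian_integral_at(2)[of "4 * h" x] h by simp
    finally show ?thesis using False by (simp add: g_def mult_ac)
  qed
qed

text \<open>For \<open>y\<close> in the half space \<open>M - v y\<close> is nonnegative, so its
  larger kernel value may be lowered to the one at the mirror image. The pair then contributes at
  least (2M - v(y) - v(y')) K(y'), hence at least A K(y'), whatever the sign of M - v(y') at the
  mirror image y'. It remains to bound K(y') below by a Gaussian.\<close>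

lemma antisymmetric_max_lower_bound:
  fixes x :: "real^'n::{finite,wellorder}" and v :: "real^'n::{finite,wellorder} \<Rightarrow> real"
  assumes i: "integrable lborel (\<lambda>y. (M - v y) * exp (- (norm (x - y))\<^sup>2 / (4 * h)))"
    and h: "h > 0" and x: "x1 x < lam" "lam - x1 x \<le> 3 * r"
    and le: "\<And>y. x1 y < lam \<Longrightarrow> v y \<le> M"
    and sum: "\<And>y. x1 y < lam \<Longrightarrow> v y + v (refl_lam lam y) \<le> e"
    and A: "0 \<le> A" "A \<le> 2 * M - e"
  shows "A / 2 * exp (- 18 * r\<^sup>2 / h) * (2 * pi * h) powr (real CARD('n) / 2)
     \<le> (LINT y|lborel. (M - v y) * exp (- (norm (x - y))\<^sup>2 / (4 * h)))"
proof -
  define K where "K = (\<lambda>y. exp (- (norm (x - y))\<^sup>2 / (4 * h)))"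
  define V where "V = (\<lambda>y. (M - v y) * K y)"
  have V: "integrable lborel V" using i by (simp add: V_def K_def)
  define G where "G = (\<lambda>y. A / 2 * exp (- 18 * r\<^sup>2 / h) * exp (- (norm (x - y))\<^sup>2 / (2 * h)))"
  \<comment> \<open>The second bound is the one needed for points beyond the hyperplane: they are
    the mirror images of some \<open>y\<close> here, and \<open>G\<close> is evaluated at
    them.\<close>
  have lower: "A * (exp (- 18 * r\<^sup>2 / h) * exp (- (norm (x - y))\<^sup>2 / (2 * h))) \<le> V y + V (refl_lam lam y)
     \<and> A * (exp (- 18 * r\<^sup>2 / h) * exp (- (norm (x - refl_lam lam y))\<^sup>2 / (2 * h))) \<le> V y + V (refl_lam lam y)"
    if y: "x1 y < lam" for y
  proof -
    define d d' where "d = norm (x - y)" and "d' = norm (x - refl_lam lam y)"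
    have eq: "d'\<^sup>2 = d\<^sup>2 + 4 * (lam - x1 x) * (lam - x1 y)" unfolding d_def d'_def by (rule norm_diff_refl_lam)
    have nn: "0 \<le> 4 * (lam - x1 x) * (lam - x1 y)" using x y by simp
    have "lam - x1 y \<le> 3 * r + d" using x1_diff_le_norm[of x y] x by (simp add: d_def)
    then have "4 * (lam - x1 x) * (lam - x1 y) \<le> 4 * (3 * r) * (3 * r + d)"
      using x y by (intro mult_mono) auto
    \<comment> \<open>The product is 36 r^2 + 12 r d, and 12 r d \<le> 36 r^2 + d^2. Division by 4h
      turns the 72 into the 18 of the exponent.\<close>
    also have "\<dots> \<le> 72 * r\<^sup>2 + d\<^sup>2"
      using zero_le_power2[of "6 * r - d"] by (simp add: power2_eq_square algebra_simps)
    finally have up: "d'\<^sup>2 \<le> 72 * r\<^sup>2 + 2 * d\<^sup>2" using eq by simp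
    have KR: "exp (- 18 * r\<^sup>2 / h) * exp (- d\<^sup>2 / (2 * h)) \<le> K (refl_lam lam y)"
    proof -
      have "- 18 * r\<^sup>2 / h + - d\<^sup>2 / (2 * h) = - (72 * r\<^sup>2 + 2 * d\<^sup>2) / (4 * h)"
        using h by (simp add: field_simps)
      also have "\<dots> \<le> - d'\<^sup>2 / (4 * h)" using up h by (intro divide_right_mono) auto
      finally show ?thesis by (simp add: K_def d'_def flip: exp_add)
    qed
    have "d\<^sup>2 \<le> d'\<^sup>2" using eq nn by simp
    then have "- d'\<^sup>2 / (2 * h) \<le> - d\<^sup>2 / (2 * h)" using h by (intro divide_right_mono) auto
    then have KR': "exp (- 18 * r\<^sup>2 / h) * exp (- d'\<^sup>2 / (2 * h)) \<le> K (refl_lam lam y)"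
      by (intro order_trans[OF _ KR]) simp
    have "- d'\<^sup>2 / (4 * h) \<le> - d\<^sup>2 / (4 * h)" using \<open>d\<^sup>2 \<le> d'\<^sup>2\<close> h by (intro divide_right_mono) auto
    then have "K (refl_lam lam y) \<le> K y" by (simp add: K_def d_def d'_def)
    then have "(M - v y) * K (refl_lam lam y) \<le> V y" unfolding V_def using le[OF y] by (intro mult_left_mono) auto
    then have "(2 * M - (v y + v (refl_lam lam y))) * K (refl_lam lam y) \<le> V y + V (refl_lam lam y)"
      by (simp add: V_def algebra_simps)
    moreover have "A * K (refl_lam lam y) \<le> (2 * M - (v y + v (refl_lam lam y))) * K (refl_lam lam y)"
      using A sum[OF y] by (intro mult_right_mono) (auto simp: K_def)
    ultimately have *: "A * K (refl_lam lam y) \<le> V y + V (refl_lam lam y)" by linarith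
    show ?thesis
      using order_trans[OF mult_left_mono[OF KR A(1)] *] order_trans[OF mult_left_mono[OF KR' A(1)] *]
      by (simp add: d_def d'_def)
  qed
  have "A / 2 * exp (- 18 * r\<^sup>2 / h) * (2 * pi * h) powr (real CARD('n) / 2) = (LINT y|lborel. G y)"
    unfolding G_def using gaussian_integral_at(2)[of "2 * h" x] h by (simp add: mult_ac)
  also have "\<dots> \<le> (LINT y|lborel. (V y + V (refl_lam lam y)) / 2)"
  proof (rule integral_mono_AE)
    show "integrable lborel G" unfolding G_def
      using h by (intro integrable_mult_right gaussian_integral_at) auto
    show "integrable lborel (\<lambda>y. (V y + V (refl_lam lam y)) / 2)" using integral_symmetrize_refl(1)[OF V] by auto
    show "AE y in lborel. G y \<le> (V y + V (refl_lam lam y)) / 2"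
      using AE_not_in_T_lam[of lam]
    proof eventually_elim
      case (elim y)
      show ?case
      proof (cases "x1 y < lam")
        case True
        then show ?thesis using lower[of y] by (simp add: G_def)
      next
        case False
        then have "x1 (refl_lam lam y) < lam" using elim by (simp add: x1_refl_lam)
        from lower[OF this] show ?thesis by (simp add: G_def)
      qed
    qed
  qed
  also have "\<dots> = (LINT y|lborel. V y)" using integral_symmetrize_refl(2)[OF V] by simp
  finally show ?thesis by (simp add: V_def K_def)
qed

section \<open>Positivity at a touching point\<close>

text \<open>The integral for \<open>w\<close> is the folded one for the perturbed function minus
  \<open>e\<close> times the one for the bump. For h < r^2 the folded part is only used as
  nonnegative, since exp(-18 r^2/h) degenerates; for h \<ge> r^2 it keeps the factor exp(-18), and
  positivity comes from there.\<close>

lemma frac_slice_lower_bound: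
  fixes w :: "real^'n::{finite,wellorder} \<Rightarrow> real \<Rightarrow> real" and x x0 :: "real^'n::{finite,wellorder}"
  assumes F: "integrable lborel (\<lambda>y. frac_heat_integrand s w x t y \<tau>)" and \<tau>: "\<tau> < t"
    and r: "r > 0" "lam - x1 x0 = 2 * r" and e: "e \<ge> 0" and pos: "bump x0 t0 r x t > 0"
    and max: "\<And>y. x1 y < lam \<Longrightarrow> w y \<tau> + e * bump x0 t0 r y \<tau> \<le> w x t + e * bump x0 t0 r x t"
    and anti: "\<And>y. x1 y < lam \<Longrightarrow> w y \<tau> = - w (refl_lam lam y) \<tau>"
    and A: "0 \<le> A" "A \<le> 2 * (w x t + e * bump x0 t0 r x t) - e"
  shows "(if t - \<tau> < r\<^sup>2 then - e * 48 * (8 * pi) powr (real CARD('n) / 2) / r\<^sup>2 * (t - \<tau>) powr (- s)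
     else (A / 2 * exp (- 18) * (2 * pi) powr (real CARD('n) / 2) - e * (4 * pi) powr (real CARD('n) / 2)) * (t - \<tau>) powr (- 1 - s))
     \<le> (LINT y|lborel. frac_heat_integrand s w x t y \<tau>)"
proof -
  define h where "h = t - \<tau>"
  define n where "n = real CARD('n)"
  have h: "h > 0" "\<tau> = t - h" using \<tau> by (auto simp: h_def)
  define \<eta> where "\<eta> = bump x0 t0 r"
  define K where "K = (\<lambda>y. exp (- (norm (x - y))\<^sup>2 / (4 * h)))"
  define M where "M = w x t + e * \<eta> x t"
  define v where "v = (\<lambda>y. w y \<tau> + e * \<eta> y \<tau>)"
  define hp where "hp = h powr (n / 2 + 1 + s)"
  have hp: "hp > 0" using h by (simp add: hp_def)
  have Feq: "frac_heat_integrand s w x t y \<tau> = (w x t - w y \<tau>) * K y / hp" for y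
    by (simp add: frac_heat_integrand_def K_def hp_def h_def n_def)
  have iw: "integrable lborel (\<lambda>y. (w x t - w y \<tau>) * K y)"
    using integrable_mult_left[OF F, of hp] hp by (simp add: Feq)
  have i\<eta>: "integrable lborel (\<lambda>y. (\<eta> x t - \<eta> y \<tau>) * K y)"
    unfolding \<eta>_def K_def by (rule bump_slice_integrable[OF h(1)])
  have eqv: "(M - v y) * K y = (w x t - w y \<tau>) * K y + e * ((\<eta> x t - \<eta> y \<tau>) * K y)" for y
    by (simp add: M_def v_def algebra_simps)
  have iv: "integrable lborel (\<lambda>y. (M - v y) * K y)" unfolding eqv using iw i\<eta> by auto
  have near: "norm (x - x0) < r" using bump_pos_imp[OF pos r(1)] by simp
  have xl: "x1 x < lam" "lam - x1 x \<le> 3 * r" using x1_diff_le_norm[of x x0] near r by linarith+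
  \<comment> \<open>Points beyond the hyperplane are more than 2r from \<open>x0\<close>, outside
    the support of the bump. So in the sum over a mirror pair \<open>w\<close> cancels and at most
    one bump value remains.\<close>
  have out: "\<eta> (refl_lam lam y) \<tau> = 0" if "x1 y < lam" for y
  proof (rule ccontr)
    assume "\<not> ?thesis"
    then have "bump x0 t0 r (refl_lam lam y) \<tau> > 0" using bump_bounds(1)[of x0 t0 r "refl_lam lam y" \<tau>] by (simp add: \<eta>_def)
    from bump_pos_imp(1)[OF this r(1)] show False
      using x1_diff_le_norm[of "refl_lam lam y" x0] that r by (simp add: x1_refl_lam)
  qed
  have sum: "v y + v (refl_lam lam y) \<le> e" if "x1 y < lam" for y
    using out[OF that] anti[OF that] bump_bounds(2)[of x0 t0 r y \<tau>] e
    by (simp add: v_def \<eta>_def mult_left_le)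
  have lo: "A / 2 * exp (- 18 * r\<^sup>2 / h) * (2 * pi * h) powr (n / 2) \<le> (LINT y|lborel. (M - v y) * K y)"
    unfolding K_def n_def using iv max sum A h xl unfolding K_def
    by (intro antisymmetric_max_lower_bound[where lam = lam and e = e]) (auto simp: v_def M_def \<eta>_def)
  have up: "(LINT y|lborel. (\<eta> x t - \<eta> y \<tau>) * K y) \<le>
      (if h < r\<^sup>2 then 48 * h / r\<^sup>2 * (8 * pi * h) powr (n / 2) else (4 * pi * h) powr (n / 2))"
    unfolding \<eta>_def K_def h(2) n_def by (rule bump_slice_upper_bound[OF pos r(1) h(1)])
  have "(LINT y|lborel. (M - v y) * K y) = (LINT y|lborel. (w x t - w y \<tau>) * K y) + e * (LINT y|lborel. (\<eta> x t - \<eta> y \<tau>) * K y)"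
    unfolding eqv using iw i\<eta> by simp
  with lo mult_left_mono[OF up e] have main:
    "A / 2 * exp (- 18 * r\<^sup>2 / h) * (2 * pi * h) powr (n / 2) -
      e * (if h < r\<^sup>2 then 48 * h / r\<^sup>2 * (8 * pi * h) powr (n / 2) else (4 * pi * h) powr (n / 2)) \<le>
     (LINT y|lborel. (w x t - w y \<tau>) * K y)" by linarith
  have J: "(LINT y|lborel. frac_heat_integrand s w x t y \<tau>) = (LINT y|lborel. (w x t - w y \<tau>) * K y) / hp"
    unfolding Feq by simp
  have hd: "h powr (n / 2) / hp = h powr (- 1 - s)" using h by (simp add: hp_def flip: powr_diff)
  show ?thesis
  proof (cases "h < r\<^sup>2")
    case True
    have "- e * (48 * h / r\<^sup>2 * (8 * pi * h) powr (n / 2)) \<le> (LINT y|lborel. (w x t - w y \<tau>) * K y)"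
      using main True A by (smt (verit) divide_nonneg_nonneg exp_ge_zero mult_minus_left mult_nonneg_nonneg powr_ge_zero)
    then have "- e * (48 * h / r\<^sup>2 * (8 * pi * h) powr (n / 2)) / hp \<le> (LINT y|lborel. frac_heat_integrand s w x t y \<tau>)"
      unfolding J using hp by (intro divide_right_mono) auto
    also have "- e * (48 * h / r\<^sup>2 * (8 * pi * h) powr (n / 2)) / hp =
        - e * 48 * (8 * pi) powr (n / 2) / r\<^sup>2 * (h * (h powr (n / 2) / hp))"
      by (simp only: powr_mult[of "8 * pi"]) (simp add: mult_ac)
    also have "h * (h powr (n / 2) / hp) = h powr (- s)"
      unfolding hd using h by (simp add: powr_diff powr_minus field_simps)
    finally show ?thesis using True by (simp add: h_def n_def)
  next
    case False
    then have "- 18 \<le> - 18 * r\<^sup>2 / h" using h by (simp add: field_simps)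
    then have "A / 2 * exp (- 18) * (2 * pi * h) powr (n / 2) \<le> A / 2 * exp (- 18 * r\<^sup>2 / h) * (2 * pi * h) powr (n / 2)"
      using A by (intro mult_right_mono mult_left_mono) auto
    then have "A / 2 * exp (- 18) * (2 * pi * h) powr (n / 2) - e * (4 * pi * h) powr (n / 2) \<le> (LINT y|lborel. (w x t - w y \<tau>) * K y)"
      using main False by (simp del: mult_minus_left)
    then have "(A / 2 * exp (- 18) * (2 * pi * h) powr (n / 2) - e * (4 * pi * h) powr (n / 2)) / hp \<le> (LINT y|lborel. frac_heat_integrand s w x t y \<tau>)"
      unfolding J using hp by (intro divide_right_mono) auto
    also have "(A / 2 * exp (- 18) * (2 * pi * h) powr (n / 2) - e * (4 * pi * h) powr (n / 2)) / hp =
        (A / 2 * exp (- 18) * (2 * pi) powr (n / 2) - e * (4 * pi) powr (n / 2)) * (h powr (n / 2) / hp)"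
      by (simp only: powr_mult[of "2 * pi"] powr_mult[of "4 * pi"]) (simp add: field_simps)
    finally show ?thesis unfolding hd using False by (simp add: h_def n_def)
  qed
qed

text \<open>Integrating the slice bounds in time gives r^(-2s)/s from h \<ge> r^2 and r^(-2)
  r^(2-2s)/(1-s) from h < r^2. The common factor r^(-2s) drops out, which is why
  \<open>small\<close> does not mention \<open>r\<close>.\<close>

lemma frac_heat_positive_at_touching_point:
  fixes w :: "real^'n::{finite,wellorder} \<Rightarrow> real \<Rightarrow> real" and x x0 :: "real^'n::{finite,wellorder}"
  assumes s: "0 < s" "s < 1"
    and J: "set_integrable lborel {..<t} (\<lambda>\<tau>. LINT y|lborel. frac_heat_integrand s w x t y \<tau>)"
    and F: "AE \<tau> in lborel. \<tau> < t \<longrightarrow> integrable lborel (\<lambda>y. frac_heat_integrand s w x t y \<tau>)"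
    and inner: "\<And>\<tau>. \<tau> < t \<Longrightarrow> frac_heat_inner s w x t \<tau> = (LINT y|lborel. frac_heat_integrand s w x t y \<tau>)"
    and r: "r > 0" "lam - x1 x0 = 2 * r" and e: "e \<ge> 0" and pos: "bump x0 t0 r x t > 0"
    and max: "\<And>y \<tau>. x1 y < lam \<Longrightarrow> w y \<tau> + e * bump x0 t0 r y \<tau> \<le> w x t + e * bump x0 t0 r x t"
    and anti: "\<And>y \<tau>. x1 y < lam \<Longrightarrow> w y \<tau> = - w (refl_lam lam y) \<tau>"
    and A: "0 \<le> A" "A \<le> 2 * (w x t + e * bump x0 t0 r x t) - e"
    and small: "e * ((4 * pi) powr (real CARD('n) / 2) / s + 48 * (8 * pi) powr (real CARD('n) / 2) / (1 - s))
        < A / 2 * exp (- 18) * (2 * pi) powr (real CARD('n) / 2) / s"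
  shows "frac_heat s w x t > 0"
proof -
  define c1 c2 where "c1 = A / 2 * exp (- 18) * (2 * pi) powr (real CARD('n) / 2) - e * (4 * pi) powr (real CARD('n) / 2)"
    and "c2 = e * 48 * (8 * pi) powr (real CARD('n) / 2)"
  define g where "g = (\<lambda>\<tau>. c1 * (indicator {..t - r\<^sup>2} \<tau> * (t - \<tau>) powr (- 1 - s))
      - c2 / r\<^sup>2 * (indicator {t - r\<^sup>2..<t} \<tau> * (t - \<tau>) powr (- s)))"
  have g: "has_bochner_integral lborel g
      (c1 * (- ((r\<^sup>2) powr (- 1 - s + 1)) / (- 1 - s + 1)) - c2 / r\<^sup>2 * ((r\<^sup>2) powr (- s + 1) / (- s + 1)))"
    unfolding g_def using r s
    by (intro has_bochner_integral_diff has_bochner_integral_mult_right has_bochner_integral_powr_far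
      has_bochner_integral_powr_near) auto
  have "(r\<^sup>2) powr (- s + 1) = r\<^sup>2 * (r\<^sup>2) powr (- s)" using r unfolding powr_add by simp
  then have val: "c1 * (- ((r\<^sup>2) powr (- 1 - s + 1)) / (- 1 - s + 1)) - c2 / r\<^sup>2 * ((r\<^sup>2) powr (- s + 1) / (- s + 1))
      = (r\<^sup>2) powr (- s) * (c1 / s - c2 / (1 - s))"
    using r by (simp add: field_simps)
  have "c1 / s - c2 / (1 - s) > 0" using small by (simp add: c1_def c2_def algebra_simps diff_divide_distrib)
  then have "(LINT \<tau>|lborel. g \<tau>) > 0" using has_bochner_integral_integral_eq[OF g] r unfolding val by simp
  also have "(LINT \<tau>|lborel. g \<tau>) \<le> (LINT \<tau>|lborel. indicator {..<t} \<tau> *\<^sub>R (LINT y|lborel. frac_heat_integrand s w x t y \<tau>))"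
  proof (rule integral_mono_AE)
    show "integrable lborel g" using g by (simp add: has_bochner_integral_iff)
    \<comment> \<open>The two indicators in \<open>g\<close> overlap at \<tau> = t - r^2, so this
      single time is excluded.\<close>
    show "AE \<tau> in lborel. g \<tau> \<le> indicator {..<t} \<tau> *\<^sub>R (LINT y|lborel. frac_heat_integrand s w x t y \<tau>)"
      using F AE_lborel_singleton[of "t - r\<^sup>2"]
    proof eventually_elim
      case (elim \<tau>)
      show ?case
      proof (cases "\<tau> < t")
        case True
        then have "(if t - \<tau> < r\<^sup>2 then - e * 48 * (8 * pi) powr (real CARD('n) / 2) / r\<^sup>2 * (t - \<tau>) powr (- s)
          else (A / 2 * exp (- 18) * (2 * pi) powr (real CARD('n) / 2) - e * (4 * pi) powr (real CARD('n) / 2)) * (t - \<tau>) powr (- 1 - s))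
          \<le> (LINT y|lborel. frac_heat_integrand s w x t y \<tau>)"
          using elim by (intro frac_slice_lower_bound[OF _ _ r e pos] max anti A) auto
        then show ?thesis using True elim by (auto simp: g_def c1_def c2_def indicator_def split: if_splits)
      next
        case False
        moreover have "0 < r\<^sup>2" using r by simp
        ultimately have "\<not> \<tau> \<le> t - r\<^sup>2" by linarith
        with False show ?thesis by (simp add: g_def)
      qed
    qed
  qed (use J in \<open>simp add: set_integrable_def\<close>)
  also have "\<dots> = (LINT \<tau> : {..<t} | lborel. frac_heat_inner s w x t \<tau>)"
    unfolding set_lebesgue_integral_def by (intro Bochner_Integration.integral_cong) (auto simp: inner indicator_def)
  finally have "0 < (LINT \<tau> : {..<t} | lborel. frac_heat_inner s w x t \<tau>)" .
  moreover have "C_ns CARD('n) s > 0"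
  proof -
    \<comment> \<open>At its poles \<open>Gamma\<close> has the default value 0, which would make
      the constant 0; -s lies strictly between -1 and 0 and is no pole.\<close>
    have "- s \<notin> \<int>\<^sub>\<le>\<^sub>0"
    proof
      assume "- s \<in> \<int>\<^sub>\<le>\<^sub>0"
      then obtain k :: int where "- s = of_int k" by (auto simp: nonpos_Ints_def)
      then have "real_of_int (- 1) < real_of_int k" "real_of_int k < real_of_int 0" using s by simp_all
      then have "- 1 < k" "k < 0" by (simp_all only: of_int_less_iff)
      then show False by simp
    qed
    then show ?thesis by (simp add: C_ns_def Gamma_eq_zero_iff)
  qed
  ultimately show ?thesis by (simp add: frac_heat_def)
qed

section \<open>From an almost maximal point to the contradiction\<close>

lemma open_Sigma_lam: "open (Sigma_lam lam :: (real^'n::{finite,wellorder}) set)"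
  unfolding Sigma_lam_def x1_def by (intro open_Collect_less continuous_intros)

text \<open>Compactness of the closed cylinder gives a maximum there, with value above
  \<open>A\<close>. Where the bump vanishes the perturbed function is at most \<open>A\<close>, so
  this maximum is global over the half space and its point lies where the bump is positive.\<close>

lemma bump_perturbation_attains_max:
  fixes w :: "real^'n::{finite,wellorder} \<Rightarrow> real \<Rightarrow> real" and x0 :: "real^'n::{finite,wellorder}"
  assumes c: "continuous_on (Sigma_lam lam \<times> UNIV) (\<lambda>p. w (fst p) (snd p))"
    and r: "r > 0" "lam - x1 x0 = 2 * r" and e: "e > 0"
    and A: "\<And>y \<tau>. x1 y < lam \<Longrightarrow> w y \<tau> \<le> A" "A < w x0 t0 + e"
  obtains x t where "bump x0 t0 r x t > 0" "A < w x t + e * bump x0 t0 r x t"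
    "\<And>y \<tau>. x1 y < lam \<Longrightarrow> w y \<tau> + e * bump x0 t0 r y \<tau> \<le> w x t + e * bump x0 t0 r x t"
proof -
  define Q where "Q = cball x0 r \<times> {t0 - r\<^sup>2..t0 + r\<^sup>2}"
  define v where "v = (\<lambda>p. w (fst p) (snd p) + e * bump x0 t0 r (fst p) (snd p))"
  have inS: "x1 y < lam" if "norm (y - x0) \<le> r" for y
    using x1_diff_le_norm[of y x0] that r by linarith
  then have QS: "Q \<subseteq> Sigma_lam lam \<times> UNIV"
    by (auto simp: Q_def Sigma_lam_def dist_norm norm_minus_commute)
  have "compact Q" unfolding Q_def by (intro compact_Times) auto
  moreover have "Q \<noteq> {}" using r by (auto simp: Q_def)
  moreover have "continuous_on Q v" unfolding v_def
    using continuous_on_subset[OF c QS] continuous_bump by (intro continuous_intros) auto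
  ultimately obtain p where p: "p \<in> Q" "\<And>q. q \<in> Q \<Longrightarrow> v q \<le> v p"
    using continuous_attains_sup[of Q v] by blast
  have "(x0, t0) \<in> Q" using r by (simp add: Q_def)
  from p(2)[OF this] have big: "A < v p" using A(2) by (simp add: v_def bump_center)
  obtain x t where xt: "p = (x, t)" by force
  have xS: "x1 x < lam" using p(1) xt QS by (auto simp: Sigma_lam_def)
  show ?thesis
  proof (rule that[of x t])
    have "bump x0 t0 r x t \<noteq> 0" using big A(1)[OF xS, of t] by (auto simp: v_def xt)
    then show "bump x0 t0 r x t > 0" using bump_bounds(1)[of x0 t0 r x t] by linarith
    show "A < w x t + e * bump x0 t0 r x t" using big by (simp add: v_def xt)
    fix y :: "real^'n::{finite,wellorder}" and \<tau> assume y: "x1 y < lam"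
    show "w y \<tau> + e * bump x0 t0 r y \<tau> \<le> w x t + e * bump x0 t0 r x t"
    proof (cases "bump x0 t0 r y \<tau> > 0")
      case True
      then have "(y, \<tau>) \<in> Q" using bump_pos_imp[OF True r(1)] by (auto simp: Q_def dist_norm norm_minus_commute)
      from p(2)[OF this] show ?thesis by (simp add: v_def xt)
    next
      case False
      then have "bump x0 t0 r y \<tau> = 0" using bump_bounds(1)[of x0 t0 r y \<tau>] by linarith
      then show ?thesis using A(1)[OF y, of \<tau>] big by (simp add: v_def xt)
    qed
  qed
qed

theorem theorem1p3:
  fixes s \<epsilon> lam :: real and w :: "real^'n::{finite,wellorder} \<Rightarrow> real \<Rightarrow> real"
  assumes s: "0 < s" "s < 1"
    and eps: "\<epsilon> > 0"
    and reg: "par_holder_loc (s + \<epsilon>) (Sigma_lam lam \<times> UNIV) w"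
    and inL: "w \<in> space_L s"
    and usc: "usc_on ((Sigma_lam lam \<union> T_lam lam) \<times> UNIV) (\<lambda>p. w (fst p) (snd p))"
    and bdd: "\<exists>M. \<forall>x\<in>Sigma_lam lam. \<forall>t. w x t \<le> M"
    and eq: "\<forall>x\<in>Sigma_lam lam. \<forall>t. w x t > 0 \<longrightarrow> frac_heat s w x t \<le> 0"
    and anti: "\<forall>x\<in>Sigma_lam lam. \<forall>t. w x t = - w (refl_lam lam x) t"
  shows "\<forall>x\<in>Sigma_lam lam. \<forall>t. w x t \<le> 0"
proof (rule ccontr)
  assume "\<not> ?thesis"
  then obtain z0 \<tau>0 where z0: "z0 \<in> Sigma_lam lam" "w z0 \<tau>0 > 0" by (auto simp: not_le)
  have cont: "continuous_on (Sigma_lam lam \<times> UNIV) (\<lambda>p. w (fst p) (snd p))"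
    using par_holder_loc_regularity(1)[OF reg s _ open_Sigma_lam] eps by simp
  obtain a where a: "s < a" "a \<le> 1" and sd: "\<forall>x\<in>Sigma_lam lam. \<forall>t. \<exists>\<rho>>0. \<exists>C\<ge>0. cball x \<rho> \<subseteq> Sigma_lam lam \<and>
       (\<forall>z h. norm z \<le> \<rho> \<longrightarrow> 0 \<le> h \<longrightarrow> h \<le> 1 \<longrightarrow>
           \<bar>2 * w x t - w (x + z) (t - h) - w (x - z) (t - h)\<bar> \<le> C * (norm z + sqrt h) powr (2 * a))"
    using par_holder_loc_regularity(2)[OF reg s _ open_Sigma_lam] eps by auto
  define W where "W = (\<lambda>p. w (fst p) (snd p)) ` (Sigma_lam lam \<times> UNIV)"
  have W: "W \<noteq> {}" "bdd_above W" using z0 bdd by (auto simp: W_def bdd_above_def)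
  define A where "A = Sup W"
  have up: "w y \<tau> \<le> A" if "x1 y < lam" for y \<tau>
    unfolding A_def using that W by (intro cSup_upper) (auto simp: W_def Sigma_lam_def image_iff)
  have A: "A > 0" using up[of z0 \<tau>0] z0 by (simp add: Sigma_lam_def)
  define k1 k2 where "k1 = (4 * pi) powr (real CARD('n) / 2) / s + 48 * (8 * pi) powr (real CARD('n) / 2) / (1 - s)"
    and "k2 = A / 2 * exp (- 18) * (2 * pi) powr (real CARD('n) / 2) / s"
  have k: "k1 > 0" "k2 > 0" using s A by (auto simp: k1_def k2_def intro!: add_pos_pos divide_pos_pos mult_pos_pos)
  \<comment> \<open>The bound A/2 keeps \<open>w\<close> positive at the touching point, where it
    exceeds A - e; the other bound gives the strict smallness condition. Both are fixed before
    \<open>x0\<close> and \<open>r\<close> exist.\<close>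
  define e where "e = min (A / 2) (k2 / k1 / 2)"
  have e: "e > 0" "e \<le> A / 2" using k A by (auto simp: e_def)
  have "e * k1 \<le> (k2 / k1 / 2) * k1" using k by (intro mult_right_mono) (auto simp: e_def)
  then have small: "e * k1 < k2" using k by simp
  obtain x0 t0 where x0: "x1 x0 < lam" "A < w x0 t0 + e"
  proof -
    have "\<exists>y\<in>W. A - e < y" using W e unfolding A_def by (intro less_cSupD) auto
    then obtain y \<tau> where "x1 y < lam" "A - e < w y \<tau>" by (auto simp: W_def Sigma_lam_def)
    then show ?thesis using that[of y \<tau>] by simp
  qed
  define r where "r = (lam - x1 x0) / 2"
  have r: "r > 0" "lam - x1 x0 = 2 * r" using x0 by (auto simp: r_def)
  obtain x t where pos: "bump x0 t0 r x t > 0" and big: "A < w x t + e * bump x0 t0 r x t" and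
    max: "\<And>y \<tau>. x1 y < lam \<Longrightarrow> w y \<tau> + e * bump x0 t0 r y \<tau> \<le> w x t + e * bump x0 t0 r x t"
    by (rule bump_perturbation_attains_max[OF cont r e(1) up x0(2)]) (assumption | rule that)+
  have "x1 x < lam" using bump_pos_imp(1)[OF pos r(1)] x1_diff_le_norm[of x x0] r by linarith
  then have xS: "x \<in> Sigma_lam lam" by (simp add: Sigma_lam_def)
  have "e * bump x0 t0 r x t \<le> e" using bump_bounds(2)[of x0 t0 r x t] e by (simp add: mult_left_le)
  then have "w x t > 0" using big e A by linarith
  then have le0: "frac_heat s w x t \<le> 0" using eq xS by blast
  obtain \<rho> C where \<rho>: "\<rho> > 0" "C \<ge> 0" "cball x \<rho> \<subseteq> Sigma_lam lam" and
    sdx: "\<And>z h. norm z \<le> \<rho> \<Longrightarrow> 0 \<le> h \<Longrightarrow> h \<le> 1 \<Longrightarrow>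
           \<bar>2 * w x t - w (x + z) (t - h) - w (x - z) (t - h)\<bar> \<le> C * (norm z + sqrt h) powr (2 * a)"
    using sd xS by meson
  have cw: "continuous_on (cball x \<rho>) (\<lambda>y. w y \<tau>)" for \<tau>
  proof -
    have "continuous_on (cball x \<rho>) (\<lambda>y. (y, \<tau>))" by (intro continuous_intros)
    moreover have "(\<lambda>y. (y, \<tau>)) ` cball x \<rho> \<subseteq> Sigma_lam lam \<times> UNIV" using \<rho>(3) by auto
    ultimately show ?thesis using continuous_on_compose2[OF cont, of "cball x \<rho>" "\<lambda>y. (y, \<tau>)"] by simp
  qed
  note J = frac_heat_slices_integrable[OF inL s(1) \<rho>(1) cw a \<rho>(2) sdx]
  have "frac_heat s w x t > 0"
  proof (rule frac_heat_positive_at_touching_point[OF s J(1) J(2) frac_heat_inner_eq[OF inL \<rho>(1) cw] r _ pos max])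
    have "A + A - e \<le> 2 * (w x t + e * bump x0 t0 r x t) - e" using big by simp
    then show "A \<le> 2 * (w x t + e * bump x0 t0 r x t) - e" using e A by linarith
    show "e * ((4 * pi) powr (real CARD('n) / 2) / s + 48 * (8 * pi) powr (real CARD('n) / 2) / (1 - s))
        < A / 2 * exp (- 18) * (2 * pi) powr (real CARD('n) / 2) / s"
      using small by (simp add: k1_def k2_def)
  qed (use e A anti in \<open>auto simp: Sigma_lam_def\<close>)
  with le0 show False by simp
qed

end
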